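(* Let $\mathcal{D}$ be an arbitrary distribution on polygonal curves of complexity $m$ whose vertices lie in the unit Euclidean ball $B_2^d\subseteq\mathbb{R}^d$. Let $P=\{\sigma_1,\dots,\sigma_n\}$ be an i.i.d. sample from $\mathcal{D}$ of size $n$. Then the Rademacher and Gaussian complexities for learning the median curve of complexity $m$ satisfy $$\mathcal{R}(P),\mathcal{G}(P)\in O\!\left(\sqrt{\frac{m^3\cdot\min\{d\log m,\ m^2\log^4(mn)\}}{n}}\right)$$ when $d(\cdot,\cdot)$ is the DTW distance, and $$\mathcal{R}(P),\mathcal{G}(P)\in O\!\left(\sqrt{\frac{m k^2\cdot\min\{d\log k,\ k^2\log^4(mn)\}}{n}}\right)$$ when $d(\cdot,\cdot)$ is the $k$-DTW distance.
   Context: Curves are vertex sequences. For $\sigma=(v_1,\dots,v_{m'})$, $\tau=(w_1,\dots,w_{m''})$, a traversal $T$ is a sequence of index pairs starting with $(1,1)$, ending with $(m',m'')$, each $(i,j)$ followed only by $(i+1,j)$, $(i,j+1)$ or $(i+1,j+1)$. DTW: $d_{DTW}(\sigma,\tau)=\min_T\sum_{(i,j)\in T}\|v_i-w_j\|$. $k$-DTW: with $s^{(T)}_1\ge s^{(T)}_2\ge\dots$ the matched Euclidean distances of $T$ sorted non-increasingly (zeros beyond $|T|$), $d_{k\text{-}DTW}(\sigma,\tau)=\min_T\sum_{l=1}^k s^{(T)}_l$. Candidate median curves $\psi$ range over curves of complexity $m$ with vertices in $B_2^d$. With $r_1,\dots,r_n$ independent Rademacher ($\pm1$) variables and $g_1,\dots,g_n$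 independent standard Gaussians, $\mathcal{R}(P)=\mathbb{E}\sup_\psi\left|\frac1n\sum_{i=1}^n d(\sigma_i,\psi)r_i\right|$ and $\mathcal{G}(P)=\mathbb{E}\sup_\psi\left|\frac1n\sum_{i=1}^n d(\sigma_i,\psi)g_i\right|$. The $O(\cdot)$ hides absolute constants.
   Formalization: The bounds are proved for d ≥ 1, m ≥ 2 and k ≥ 2: for k = 1 (k-DTW) or m = 1 (DTW, or k-DTW with n = 1) the logarithm makes the stated bound 0, which is false. They hold for every fixed sample P, hence for every i.i.d. sample. *)

theory Defs
  imports "HOL-Probability.Probability"
begin

text \<open>Points of R^d are real lists of length d; curves are lists of points (vertex sequences).
  Indices are 0-based.\<close>

type_synonym point = "real list"
type_synonym curve = "point list"

definition edist :: "point \<Rightarrow> point \<Rightarrow> real" where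
  "edist x y = sqrt (sum_list (map (\<lambda>(a, b). (a - b)\<^sup>2) (zip x y)))"

definition in_unit_ball :: "nat \<Rightarrow> point \<Rightarrow> bool" where
  "in_unit_ball d x \<longleftrightarrow> length x = d \<and> sum_list (map (\<lambda>a. a\<^sup>2) x) \<le> 1"

definition curves_in_ball :: "nat \<Rightarrow> nat \<Rightarrow> curve set" where
  "curves_in_ball d m = {\<psi>. length \<psi> = m \<and> (\<forall>v\<in>set \<psi>. in_unit_ball d v)}"

definition trav_step :: "nat \<times> nat \<Rightarrow> nat \<times> nat \<Rightarrow> bool" where
  "trav_step p q \<longleftrightarrow> q = (fst p + 1, snd p) \<or> q = (fst p, snd p + 1) \<or> q = (fst p + 1, snd p + 1)"

definition traversal :: "nat \<Rightarrow> nat \<Rightarrow> (nat \<times> nat) list \<Rightarrow> bool" where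
  "traversal m1 m2 T \<longleftrightarrow> T \<noteq> [] \<and> hd T = (0, 0) \<and> last T = (m1 - 1, m2 - 1) \<and>
     (\<forall>l. l + 1 < length T \<longrightarrow> trav_step (T ! l) (T ! (l + 1)))"

definition matched_dists :: "curve \<Rightarrow> curve \<Rightarrow> (nat \<times> nat) list \<Rightarrow> real list" where
  "matched_dists \<sigma> \<tau> T = map (\<lambda>(i, j). edist (\<sigma> ! i) (\<tau> ! j)) T"

definition dtw :: "curve \<Rightarrow> curve \<Rightarrow> real" where
  "dtw \<sigma> \<tau> = (INF T \<in> {T. traversal (length \<sigma>) (length \<tau>) T}. sum_list (matched_dists \<sigma> \<tau> T))"

text \<open>k-DTW: sum of the k largest matched distances (zeros beyond |T|), minimised over traversals.\<close>
definition kdtw :: "nat \<Rightarrow> curve \<Rightarrow> curve \<Rightarrow> real" where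
  "kdtw k \<sigma> \<tau> = (INF T \<in> {T. traversal (length \<sigma>) (length \<tau>) T}.
      sum_list (take k (rev (sort (matched_dists \<sigma> \<tau> T)))))"

definition rademacher_complexity ::
  "(curve \<Rightarrow> curve \<Rightarrow> real) \<Rightarrow> nat \<Rightarrow> nat \<Rightarrow> nat \<Rightarrow> (nat \<Rightarrow> curve) \<Rightarrow> real" where
  "rademacher_complexity dist_fn d m n P =
     (\<Sum>r \<in> ({..<n} \<rightarrow>\<^sub>E {-1, 1::real}).
        (SUP \<psi> \<in> curves_in_ball d m. \<bar>(1 / real n) * (\<Sum>i<n. dist_fn (P i) \<psi> * r i)\<bar>)) / 2 ^ n"

definition gauss_measure :: "nat \<Rightarrow> (nat \<Rightarrow> real) measure" where
  "gauss_measure n = PiM {..<n} (\<lambda>_. density lborel std_normal_density)"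

definition gaussian_sup ::
  "(curve \<Rightarrow> curve \<Rightarrow> real) \<Rightarrow> nat \<Rightarrow> nat \<Rightarrow> nat \<Rightarrow> (nat \<Rightarrow> curve) \<Rightarrow> (nat \<Rightarrow> real) \<Rightarrow> real" where
  "gaussian_sup dist_fn d m n P g =
     (SUP \<psi> \<in> curves_in_ball d m. \<bar>(1 / real n) * (\<Sum>i<n. dist_fn (P i) \<psi> * g i)\<bar>)"

definition gaussian_complexity ::
  "(curve \<Rightarrow> curve \<Rightarrow> real) \<Rightarrow> nat \<Rightarrow> nat \<Rightarrow> nat \<Rightarrow> (nat \<Rightarrow> curve) \<Rightarrow> real" where
  "gaussian_complexity dist_fn d m n P =
     (\<integral>g. gaussian_sup dist_fn d m n P g \<partial>gauss_measure n)"

end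

theory Submission
  imports Defs
begin

text \<open>
  Both distances are \<open>k\<close>-Lipschitz in the sup norm of the matrix of vertex distances (DTW being
  \<open>k\<close>-DTW for \<open>k \<ge> 2m + 1\<close>), so Dudley chaining reduces everything to covering numbers of
  the maps \<open>v \<mapsto> (\<parallel>p - v\<parallel>)\<^sub>p\<close>, where \<open>v\<close> ranges over the unit ball and \<open>p\<close> over the
  \<open>N = mn\<close> sample vertices. At scale \<open>2\<^bsup>-j\<^esup>\<close> a grid gives log-cardinality \<open>O(d (j + 1))\<close>,
  whose entropy sum converges. A dimension-free cover of log-cardinality \<open>O(4\<^bsup>j\<^esup> log N)\<close> comes from the
  perceptron: with \<open>p\<^sub>0\<close> the sample vertex nearest to \<open>v\<close>, the inner products of \<open>v - p\<^sub>0\<close> with the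
  normalised differences \<open>(p - p\<^sub>0) / \<parallel>p - p\<^sub>0\<parallel>\<close> are determined up to \<open>\<epsilon>\<close> by a list of \<open>O(\<epsilon>\<^sup>-\<^sup>2)\<close>
  signed sample vertices. Because \<open>p\<^sub>0\<close> is nearest, \<open>\<parallel>p - p\<^sub>0\<parallel> \<le> 2 \<parallel>p - v\<parallel>\<close>, so the error in the
  squared distance is \<open>O(\<epsilon> \<parallel>p - v\<parallel>)\<close> and the error in the distance is \<open>O(\<epsilon>)\<close>. Truncating the chain
  after \<open>O(log n)\<close> scales gives the second bound.
\<close>

section \<open>Covering the distance profiles of points in the ball\<close>

lemma edist_eq_L2_set:
  assumes "length x = d" "length y = d"
  shows "edist x y = L2_set (\<lambda>t. x ! t - y ! t) {..<d}"
  using assms unfolding edist_def L2_set_def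
  by (simp add: sum_list_sum_nth atLeast0LessThan)

lemma in_unit_ball_iff:
  "in_unit_ball d x \<longleftrightarrow> length x = d \<and> (\<Sum>t<d. (x ! t)\<^sup>2) \<le> 1"
  unfolding in_unit_ball_def by (auto simp: sum_list_sum_nth atLeast0LessThan)

lemma edist_nonneg: "edist x y \<ge> 0"
  unfolding edist_def
  by (intro real_sqrt_ge_zero sum_list_nonneg) auto

lemma edist_commute:
  assumes "length x = d" "length y = d"
  shows "edist x y = edist y x"
  using assms by (simp add: edist_eq_L2_set L2_set_def power2_commute)

lemma edist_triangle:
  assumes "length x = d" "length y = d" "length z = d"
  shows "edist x z \<le> edist x y + edist y z"
  using L2_set_triangle_ineq[of "\<lambda>t. x ! t - y ! t" "\<lambda>t. y ! t - z ! t" "{..<d}"] assms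
  by (simp add: edist_eq_L2_set)

lemma edist_le_2:
  assumes "in_unit_ball d x" "in_unit_ball d y"
  shows "edist x y \<le> 2"
proof -
  have "L2_set (\<lambda>t. x ! t) {..<d} \<le> 1" "L2_set (\<lambda>t. y ! t) {..<d} \<le> 1"
    using assms by (auto simp: in_unit_ball_iff L2_set_def)
  moreover have "L2_set (\<lambda>t. x ! t + - y ! t) {..<d} \<le> L2_set (\<lambda>t. x ! t) {..<d} + L2_set (\<lambda>t. - y ! t) {..<d}"
    by (rule L2_set_triangle_ineq)
  moreover have "L2_set (\<lambda>t. - y ! t) {..<d} = L2_set (\<lambda>t. y ! t) {..<d}"
    by (simp add: L2_set_def)
  ultimately show ?thesis using assms by (simp add: edist_eq_L2_set in_unit_ball_iff)
qed

text \<open>Each violated constraint triggers an update of \<open>u\<close> that lowers its squared norm by at least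
  \<open>\<epsilon>\<^sup>2\<close>, so at most \<open>K\<close> updates occur; the list \<open>L\<close> records them.\<close>

lemma perceptron_approximation:
  fixes q :: "'i \<Rightarrow> nat \<Rightarrow> real"
  assumes q: "\<And>i. i \<in> I \<Longrightarrow> (\<Sum>t<d. (q i t)\<^sup>2) \<le> 1" and eps: "\<epsilon> > 0"
    and "(\<Sum>t<d. (u t)\<^sup>2) \<le> real K * \<epsilon>\<^sup>2"
  shows "\<exists>L. set L \<subseteq> {-1, 1} \<times> I \<and> length L \<le> K \<and>
    (\<forall>i\<in>I. \<bar>(\<Sum>t<d. u t * q i t) - (\<Sum>(s, j)\<leftarrow>L. \<epsilon> * s * (\<Sum>t<d. q j t * q i t))\<bar> \<le> \<epsilon>)"
  using assms(3)
proof (induction K arbitrary: u)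
  \<comment> \<open>Expanding the square, the cross term contributes less than -2 \<epsilon>^2 by
    the violation and the quadratic term at most \<epsilon>^2, since \<open>q i\<close> has norm at
    most 1.\<close>
  have step: "(\<Sum>t<d. (u t - \<epsilon> * s * q i t)\<^sup>2) \<le> (\<Sum>t<d. (u t)\<^sup>2) - \<epsilon>\<^sup>2"
    if "i \<in> I" "s \<in> {-1, 1}" "s * (\<Sum>t<d. u t * q i t) > \<epsilon>" for u i s
  proof -
    have s2: "s * s = 1" using that by auto
    have "(\<Sum>t<d. (u t - \<epsilon> * s * q i t)\<^sup>2) = (\<Sum>t<d. (u t)\<^sup>2 - 2 * \<epsilon> * s * (u t * q i t) + (s * s) * \<epsilon>\<^sup>2 * (q i t)\<^sup>2)"
      by (intro sum.cong) (auto simp: power2_eq_square algebra_simps)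
    also have "\<dots> = (\<Sum>t<d. (u t)\<^sup>2) - 2 * \<epsilon> * (s * (\<Sum>t<d. u t * q i t)) + \<epsilon>\<^sup>2 * (\<Sum>t<d. (q i t)\<^sup>2)"
      unfolding s2 by (simp add: sum.distrib sum_subtractf sum_distrib_left mult.assoc)
    also have "\<dots> \<le> (\<Sum>t<d. (u t)\<^sup>2) - 2 * \<epsilon> * \<epsilon> + \<epsilon>\<^sup>2 * 1"
      using that q[OF that(1)] eps by (intro add_mono diff_mono mult_left_mono) auto
    finally show ?thesis by (simp add: power2_eq_square)
  qed
  have bad: "\<exists>i\<in>I. \<exists>s\<in>{-1, 1}. s * (\<Sum>t<d. u t * q i t) > \<epsilon>"
    if "\<not> (\<forall>i\<in>I. \<bar>\<Sum>t<d. u t * q i t\<bar> \<le> \<epsilon>)" for u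
    using that by (force simp: abs_le_iff not_le)
  {
    case 0
    have "\<forall>i\<in>I. \<bar>\<Sum>t<d. u t * q i t\<bar> \<le> \<epsilon>"
    proof (rule ccontr)
      assume "\<not> ?thesis"
      then obtain i s where "i \<in> I" "s \<in> {-1, 1}" "s * (\<Sum>t<d. u t * q i t) > \<epsilon>"
        using bad by blast
      \<comment> \<open>With no budget left \<open>u\<close> has norm zero, so an update would push
        a squared norm below zero.\<close>
      from step[OF this] 0 have "(\<Sum>t<d. (u t - \<epsilon> * s * q i t)\<^sup>2) \<le> - \<epsilon>\<^sup>2" by simp
      moreover have "(\<Sum>t<d. (u t - \<epsilon> * s * q i t)\<^sup>2) \<ge> 0" by (intro sum_nonneg) auto
      ultimately show False using eps by (smt (verit) zero_less_power)
    qed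
    then show ?case by (intro exI[of _ "[]"]) auto
  next
    case (Suc K)
    show ?case
    proof (cases "\<forall>i\<in>I. \<bar>\<Sum>t<d. u t * q i t\<bar> \<le> \<epsilon>")
      case True
      then show ?thesis by (intro exI[of _ "[]"]) auto
    next
      case False
      then obtain i s where i: "i \<in> I" and s: "s \<in> {-1, 1}" and g: "s * (\<Sum>t<d. u t * q i t) > \<epsilon>"
        using bad by blast
      from step[OF i s g] Suc.prems
      have "(\<Sum>t<d. (u t - \<epsilon> * s * q i t)\<^sup>2) \<le> real K * \<epsilon>\<^sup>2" by (simp add: algebra_simps)
      from Suc.IH[OF this] obtain L where L: "set L \<subseteq> {-1, 1} \<times> I" "length L \<le> K"
        "\<And>i'. i'\<in>I \<Longrightarrow> \<bar>(\<Sum>t<d. (u t - \<epsilon> * s * q i t) * q i' t) - (\<Sum>(s, j)\<leftarrow>L. \<epsilon> * s * (\<Sum>t<d. q j t * q i' t))\<bar> \<le> \<epsilon>"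
        by blast
      have eq: "(\<Sum>t<d. (u t - \<epsilon> * s * q i t) * q i' t) = (\<Sum>t<d. u t * q i' t) - \<epsilon> * s * (\<Sum>t<d. q i t * q i' t)" for i'
        by (simp add: left_diff_distrib sum_subtractf sum_distrib_left mult.assoc)
      from L(1,2) L(3)[unfolded eq] i s show ?thesis
        by (intro exI[of _ "(s, i) # L"]) (simp add: diff_diff_eq)
    qed
  }
qed

section \<open>Counting lists and the dimension-free code\<close>

lemma sum_power_le_Suc_power: "(\<Sum>i\<le>n. a ^ i) \<le> (Suc a) ^ n"
proof (induction n)
  case (Suc n)
  have "a ^ n \<le> Suc a ^ n" by (intro power_mono) auto
  then have "a * a ^ n \<le> a * Suc a ^ n" by simp
  with Suc have "(\<Sum>i\<le>n. a ^ i) + a * a ^ n \<le> Suc a ^ n + a * Suc a ^ n" by (rule add_mono)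
  then show ?case by simp
qed simp

lemma card_lists_length_le_power:
  assumes "finite A"
  shows "card {L. set L \<subseteq> A \<and> length L \<le> n} \<le> (card A + 1) ^ n"
  using card_lists_length_le[OF assms, of n] sum_power_le_Suc_power[of "card A" n] by simp

text \<open>The code of \<open>v\<close> consists of its nearest sample vertex, its distance to that
  vertex in units of \<epsilon>, and a perceptron list. The conditions on \<open>K\<close> and
  \<open>Z\<close> reflect that two points of the ball are at distance at most 2: this bounds the
  squared norm fed to the perceptron and the largest rounded distance.\<close>

lemma distance_code_dimension_free:
  fixes p :: "'i \<Rightarrow> point"
  assumes I: "finite I" "I \<noteq> {}" and p: "\<And>i. i \<in> I \<Longrightarrow> in_unit_ball d (p i)"
    and eps: "\<epsilon> > 0" and K: "4 \<le> real K * \<epsilon>\<^sup>2" and Z: "2 \<le> real Z * \<epsilon>"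
  obtains code :: "point \<Rightarrow> 'i \<times> nat \<times> (real \<times> 'i) list" and C
  where "finite C" "card C \<le> card I * ((Z + 1) * (2 * card I + 1) ^ K)"
    "\<And>v. in_unit_ball d v \<Longrightarrow> code v \<in> C"
    "\<And>v w i. in_unit_ball d v \<Longrightarrow> in_unit_ball d w \<Longrightarrow> code v = code w \<Longrightarrow> i \<in> I \<Longrightarrow>
       \<bar>edist (p i) v - edist (p i) w\<bar> \<le> 5 * \<epsilon>"
proof -
  define ip where "ip a b = (\<Sum>t<d. a t * b t)" for a b :: "nat \<Rightarrow> real"
  define C where "C = I \<times> {..Z} \<times> {L. set L \<subseteq> {-1::real, 1} \<times> I \<and> length L \<le> K}"
  \<comment> \<open>For coinciding sample vertices the quotient is 0 by the convention on division
    by zero, so \<open>q j i\<close> is either a unit vector or zero.\<close>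
  define q where "q j i t = (p i ! t - p j ! t) / edist (p i) (p j)" for j i t
  have len: "length (p i) = d" if "i \<in> I" for i using p[OF that] by (simp add: in_unit_ball_def)
  have sq: "(edist (p i) v)\<^sup>2 = (\<Sum>t<d. (p i ! t - v ! t)\<^sup>2)" if "i \<in> I" "in_unit_ball d v" for i v
    using that len by (simp add: edist_eq_L2_set[of _ d] in_unit_ball_def L2_set_def sum_nonneg)
  have qn: "(\<Sum>t<d. (q j i t)\<^sup>2) \<le> 1" if "i \<in> I" "j \<in> I" for i j
  proof -
    have "(\<Sum>t<d. (q j i t)\<^sup>2) = (edist (p i) (p j))\<^sup>2 / (edist (p i) (p j))\<^sup>2"
      unfolding q_def power_divide sum_divide_distrib[symmetric] sq[OF that(1) p[OF that(2)]] ..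
    then show ?thesis by simp
  qed
  \<comment> \<open>\<open>Q v c\<close> says that \<open>c\<close> is an admissible code of
    \<open>v\<close>. Codes need not be unique (ties, several lists), so \<open>code\<close> is
    obtained by choice.\<close>
  define Q where "Q v c \<longleftrightarrow> (case c of (j, z, L) \<Rightarrow> (\<forall>i\<in>I. edist (p j) v \<le> edist (p i) v) \<and>
      z = nat \<lfloor>edist (p j) v / \<epsilon>\<rfloor> \<and>
      (\<forall>i\<in>I. \<bar>ip (\<lambda>t. v ! t - p j ! t) (q j i) - (\<Sum>(s, l)\<leftarrow>L. \<epsilon> * s * ip (q j l) (q j i))\<bar> \<le> \<epsilon>))" for v c
  have "\<exists>c. c \<in> C \<and> Q v c"
    if v: "in_unit_ball d v" for v
  proof -
    obtain j where j: "j \<in> I" "\<forall>i\<in>I. edist (p j) v \<le> edist (p i) v"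
      using ex_is_arg_min_if_finite[OF I, of "\<lambda>i. edist (p i) v"]
      by (auto simp: is_arg_min_linorder)
    have le2: "edist (p j) v \<le> 2" using edist_le_2 p j v by blast
    have "(\<Sum>t<d. (v ! t - p j ! t)\<^sup>2) = (edist (p j) v)\<^sup>2"
      using sq[OF j(1) v] by (simp add: power2_commute)
    also have "\<dots> \<le> 2\<^sup>2" using le2 by (intro power_mono edist_nonneg)
    finally have "(\<Sum>t<d. (v ! t - p j ! t)\<^sup>2) \<le> real K * \<epsilon>\<^sup>2" using K by simp
    from perceptron_approximation[of I "q j" d, OF qn[OF _ j(1)] eps this]
    obtain L where L: "set L \<subseteq> {-1, 1} \<times> I" "length L \<le> K"
      "\<forall>i\<in>I. \<bar>ip (\<lambda>t. v ! t - p j ! t) (q j i) - (\<Sum>(s, l)\<leftarrow>L. \<epsilon> * s * ip (q j l) (q j i))\<bar> \<le> \<epsilon>"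
      unfolding ip_def by auto
    have "edist (p j) v / \<epsilon> \<le> real Z" using le2 Z eps by (simp add: divide_le_eq)
    then have "nat \<lfloor>edist (p j) v / \<epsilon>\<rfloor> \<le> Z" by linarith
    with j L show ?thesis
      by (intro exI[of _ "(j, nat \<lfloor>edist (p j) v / \<epsilon>\<rfloor>, L)"]) (simp add: C_def Q_def)
  qed
  then have "\<forall>v\<in>{v. in_unit_ball d v}. \<exists>c. c \<in> C \<and> Q v c" by blast
  then obtain code where "\<forall>v\<in>{v. in_unit_ball d v}. code v \<in> C \<and> Q v (code v)"
    by (rule bchoice[THEN exE])
  then have code: "\<And>v. in_unit_ball d v \<Longrightarrow> code v \<in> C" "\<And>v. in_unit_ball d v \<Longrightarrow> Q v (code v)"
    by auto
  have close: "\<bar>edist (p i) v - edist (p i) w\<bar> \<le> 5 * \<epsilon>"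
    if v: "in_unit_ball d v" and w: "in_unit_ball d w" and eq: "code v = code w" and i: "i \<in> I" for v w i
  proof -
    obtain j z L where c: "code v = (j, z, L)" by (metis prod_cases3)
    then have c': "code w = (j, z, L)" using eq by simp
    have j: "j \<in> I" using code(1)[OF v] c by (simp add: C_def)
    define n where "n = edist (p i) (p j)"
    define a b where "a = ip (\<lambda>t. v ! t - p j ! t) (q j i)" and "b = ip (\<lambda>t. w ! t - p j ! t) (q j i)"
    define r s where "r = edist (p j) v" and "s = edist (p j) w"
    define D E where "D = edist (p i) v" and "E = edist (p i) w"
    have nn: "n \<ge> 0" "r \<ge> 0" "s \<ge> 0" "D \<ge> 0" "E \<ge> 0"
      by (auto simp: n_def r_def s_def D_def E_def edist_nonneg)
    have "\<bar>a - b\<bar> \<le> 2 * \<epsilon>"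
      using code(2)[OF v] code(2)[OF w] i unfolding c c' Q_def a_def b_def by fastforce
    have rD: "r \<le> D" "s \<le> E" using code(2)[OF v] code(2)[OF w] i unfolding c c' Q_def r_def s_def D_def E_def by auto
    have "nat \<lfloor>r / \<epsilon>\<rfloor> = nat \<lfloor>s / \<epsilon>\<rfloor>"
      using code(2)[OF v] code(2)[OF w] unfolding c c' Q_def r_def s_def by auto
    then have "\<lfloor>r / \<epsilon>\<rfloor> = \<lfloor>s / \<epsilon>\<rfloor>" using nn eps by (simp add: nat_eq_iff)
    then have "\<bar>r / \<epsilon> - s / \<epsilon>\<bar> \<le> 1" by linarith
    then have rs: "\<bar>r - s\<bar> \<le> \<epsilon>" using eps
      by (simp add: diff_divide_distrib[symmetric] abs_divide)
    have lv: "length v = d" "length w = d" using v w by (auto simp: in_unit_ball_def)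
    have nDE: "n \<le> D + r" "n \<le> E + s"
      using edist_triangle[of "p i" d v "p j"] edist_triangle[of "p i" d w "p j"]
        edist_commute[of "p j" d v] edist_commute[of "p j" d w] len[OF i] len[OF j] lv
      by (auto simp: n_def D_def E_def r_def s_def)
    \<comment> \<open>Law of cosines with origin \<open>p j\<close>: beyond the distance to
      \<open>p j\<close>, the squared distance depends on \<open>x\<close> only through one inner
      product.\<close>
    have expand: "(edist (p i) x)\<^sup>2 = (edist (p j) x)\<^sup>2 - 2 * n * ip (\<lambda>t. x ! t - p j ! t) (q j i) + n\<^sup>2"
      if x: "in_unit_ball d x" for x
    proof -
      \<comment> \<open>If \<open>n = 0\<close> the normalisation is lost, but then the two sample
        vertices agree in every coordinate.\<close>
      have nq: "n * q j i t = p i ! t - p j ! t" if "t < d" for t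
      proof (cases "n = 0")
        case True
        then have "(\<Sum>t<d. (p i ! t - p j ! t)\<^sup>2) = 0" using sq[OF i p[OF j]] by (simp add: n_def)
        then have "(p i ! t - p j ! t)\<^sup>2 = 0" using that by (subst (asm) sum_nonneg_eq_0_iff) auto
        then show ?thesis using True by simp
      qed (simp add: q_def n_def)
      have "(edist (p i) x)\<^sup>2 = (\<Sum>t<d. (p j ! t - x ! t)\<^sup>2 - 2 * ((x ! t - p j ! t) * (p i ! t - p j ! t)) + (p i ! t - p j ! t)\<^sup>2)"
        unfolding sq[OF i x] by (intro sum.cong) (auto simp: power2_eq_square algebra_simps)
      also have "\<dots> = (edist (p j) x)\<^sup>2 - 2 * (\<Sum>t<d. (x ! t - p j ! t) * (p i ! t - p j ! t)) + n\<^sup>2"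
        unfolding sq[OF j x] n_def sq[OF i p[OF j]]
        by (simp add: sum.distrib sum_subtractf sum_distrib_left)
      also have "(\<Sum>t<d. (x ! t - p j ! t) * (p i ! t - p j ! t)) = n * ip (\<lambda>t. x ! t - p j ! t) (q j i)"
        unfolding ip_def sum_distrib_left by (intro sum.cong) (auto simp: nq[symmetric])
      finally show ?thesis by simp
    qed
    have "D\<^sup>2 - E\<^sup>2 = (r - s) * (r + s) - 2 * n * (a - b)"
      using expand[OF v] expand[OF w]
      by (simp add: D_def E_def r_def s_def a_def b_def power2_eq_square algebra_simps)
    then have "\<bar>D\<^sup>2 - E\<^sup>2\<bar> \<le> \<bar>(r - s) * (r + s)\<bar> + \<bar>2 * n * (a - b)\<bar>" by linarith
    also have "\<dots> = \<bar>r - s\<bar> * (r + s) + 2 * n * \<bar>a - b\<bar>" using nn by (simp add: abs_mult)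
    \<comment> \<open>As \<open>p j\<close> is nearest, \<open>r \<le> D\<close> and
      \<open>s \<le> E\<close>; hence \<open>n \<le> 2 * D\<close> and \<open>n \<le> 2 * E\<close>,
      so \<open>n \<le> D + E\<close>. Both error terms then carry the factor \<open>D + E\<close>,
      which cancels against \<open>D^2 - E^2\<close>.\<close>
    also have "\<dots> \<le> \<epsilon> * (D + E) + 2 * (D + E) * (2 * \<epsilon>)"
      using rs rD nDE \<open>\<bar>a - b\<bar> \<le> 2 * \<epsilon>\<close> nn eps by (intro add_mono mult_mono) auto
    finally have "\<bar>(D - E) * (D + E)\<bar> \<le> 5 * \<epsilon> * (D + E)" by (simp add: power2_eq_square algebra_simps)
    then have "\<bar>D - E\<bar> * (D + E) \<le> 5 * \<epsilon> * (D + E)" using nn by (simp add: abs_mult)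
    then have "\<bar>D - E\<bar> \<le> 5 * \<epsilon>" using nn eps
      by (cases "D + E = 0") (auto dest: mult_right_le_imp_le)
    then show ?thesis by (simp add: D_def E_def)
  qed
  have fin: "finite ({-1::real, 1} \<times> I)" using I by simp
  have "card C = card I * ((Z + 1) * card {L. set L \<subseteq> {-1::real, 1} \<times> I \<and> length L \<le> K})"
    unfolding C_def by (simp add: card_cartesian_product)
  also have "\<dots> \<le> card I * ((Z + 1) * (card ({-1::real, 1} \<times> I) + 1) ^ K)"
    by (intro mult_le_mono le_refl card_lists_length_le_power fin)
  also have "card ({-1::real, 1} \<times> I) = 2 * card I" by (simp add: card_cartesian_product)
  finally have "card C \<le> card I * ((Z + 1) * (2 * card I + 1) ^ K)" .
  moreover have "finite C" unfolding C_def using finite_lists_length_le[OF fin, of K] I by simp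
  ultimately show ?thesis using that[of C code] code(1) close by blast
qed

section \<open>The grid code and its lattice point count\<close>

text \<open>The nonnegative and the nonpositive integers each give a geometric series; counting 0
  twice only increases the bound.\<close>

lemma sum_power_nat_abs_le:
  fixes x :: real
  assumes "0 \<le> x" "x < 1"
  shows "(\<Sum>z\<in>{-int K..int K}. x ^ nat \<bar>z\<bar>) \<le> 2 / (1 - x)"
proof -
  have "{-int K..int K} \<subseteq> int ` {..K} \<union> (\<lambda>i. - int i) ` {..K}"
  proof
    fix z assume "z \<in> {-int K..int K}"
    then have "z = int (nat z) \<and> nat z \<le> K \<or> z = - int (nat (-z)) \<and> nat (-z) \<le> K" by auto
    then show "z \<in> int ` {..K} \<union> (\<lambda>i. - int i) ` {..K}" by blast
  qed
  then have "(\<Sum>z\<in>{-int K..int K}. x ^ nat \<bar>z\<bar>) \<le> (\<Sum>z\<in>int ` {..K} \<union> (\<lambda>i. - int i) ` {..K}. x ^ nat \<bar>z\<bar>)"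
    using assms by (intro sum_mono2) auto
  also have "\<dots> \<le> (\<Sum>z\<in>int ` {..K}. x ^ nat \<bar>z\<bar>) + (\<Sum>z\<in>(\<lambda>i. - int i) ` {..K}. x ^ nat \<bar>z\<bar>)"
    using assms by (subst sum.union_inter[symmetric]) (auto intro!: sum_nonneg)
  also have "\<dots> = 2 * (\<Sum>i\<le>K. x ^ i)"
    by (subst (1 2) sum.reindex) (auto simp: inj_on_def)
  also have "(\<Sum>i\<le>K. x ^ i) \<le> (\<Sum>i. x ^ i)"
    using assms by (intro sum_le_suminf summable_geometric) auto
  also have "\<dots> = 1 / (1 - x)" using assms by (intro suminf_geometric) auto
  finally show ?thesis by simp
qed

text \<open>A generating-function bound: summing \<open>x\<^bsup>|z|\<^esup>\<close> over all lattice points factorises. A cruder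
  count by boxes would lose a factor \<open>log d\<close> in the exponent.\<close>

lemma card_int_vectors_l1_le:
  fixes x :: real
  assumes "0 < x" "x < 1"
    and S: "S \<subseteq> {z \<in> {..<d} \<rightarrow>\<^sub>E {-int B..int B}. (\<Sum>t<d. nat \<bar>z t\<bar>) \<le> B}"
  shows "real (card S) * x ^ B \<le> (2 / (1 - x)) ^ d"
proof -
  have fin: "finite ({..<d} \<rightarrow>\<^sub>E {-int B..int B})" by (intro finite_PiE) auto
  have "real (card S) * x ^ B = (\<Sum>z\<in>S. x ^ B)" by simp
  also have "\<dots> \<le> (\<Sum>z\<in>S. x ^ (\<Sum>t<d. nat \<bar>z t\<bar>))"
    using S assms by (intro sum_mono power_decreasing) auto
  also have "\<dots> = (\<Sum>z\<in>S. \<Prod>t<d. x ^ nat \<bar>z t\<bar>)"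
    by (simp add: power_sum)
  also have "\<dots> \<le> (\<Sum>z\<in>{..<d} \<rightarrow>\<^sub>E {-int B..int B}. \<Prod>t<d. x ^ nat \<bar>z t\<bar>)"
    using S assms fin by (intro sum_mono2) (auto intro!: prod_nonneg)
  also have "\<dots> = (\<Prod>t<d. \<Sum>z\<in>{-int B..int B}. x ^ nat \<bar>z\<bar>)"
    by (subst prod_sum_PiE) auto
  also have "\<dots> \<le> (\<Prod>t<d. 2 / (1 - x))"
    using assms by (intro prod_mono conjI sum_power_nat_abs_le sum_nonneg) auto
  finally show ?thesis by simp
qed

text \<open>Coordinates are rounded to a grid of side \<delta> / sqrt d, whose cells have diameter
  at most \<delta>. By Cauchy-Schwarz the rounded vectors have l1 norm \<open>O(d * 2^j)\<close>, so
  the generating-function count gives cardinality \<open>2^(O(j + 1) * d)\<close>.\<close>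

lemma distance_code_grid:
  assumes d: "d \<ge> 1"
  obtains code :: "point \<Rightarrow> nat \<Rightarrow> int" and C
  where "finite C" "card C \<le> 2 ^ ((j + 5) * d)"
    "\<And>v. in_unit_ball d v \<Longrightarrow> code v \<in> C"
    "\<And>v w x. in_unit_ball d v \<Longrightarrow> in_unit_ball d w \<Longrightarrow> code v = code w \<Longrightarrow> length x = d \<Longrightarrow>
       \<bar>edist x v - edist x w\<bar> \<le> 2 / 2 ^ j"
proof -
  define \<delta> :: real where "\<delta> = 2 / 2 ^ j"
  \<comment> \<open>The scaled l1 norm is at most \<open>d * 2^j / 2\<close>, and rounding adds at
    most 1 per coordinate, so \<open>d * M\<close> bounds the l1 norm of a code.\<close>
  define M :: nat where "M = 2 ^ j + 1"
  define B where "B = d * M"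
  define code where "code v = (\<lambda>t\<in>{..<d}. \<lfloor>v ! t * sqrt d / \<delta>\<rfloor>)" for v :: point
  define C where "C = {z \<in> {..<d} \<rightarrow>\<^sub>E {-int B..int B}. (\<Sum>t<d. nat \<bar>z t\<bar>) \<le> B}"
  have dpos: "\<delta> > 0" by (simp add: \<delta>_def)
  have inC: "code v \<in> C" if v: "in_unit_ball d v" for v
  proof -
    have "(\<Sum>t<d. \<bar>v ! t\<bar> * \<bar>1\<bar>) \<le> L2_set (\<lambda>t. v ! t) {..<d} * L2_set (\<lambda>t. 1) {..<d}"
      by (rule L2_set_mult_ineq)
    also have "\<dots> \<le> 1 * sqrt d"
      using v by (intro mult_mono) (auto simp: in_unit_ball_iff L2_set_def)
    finally have l1: "(\<Sum>t<d. \<bar>v ! t\<bar>) \<le> sqrt d" by simp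
    have "real (\<Sum>t<d. nat \<bar>code v t\<bar>) = (\<Sum>t<d. \<bar>real_of_int \<lfloor>v ! t * sqrt d / \<delta>\<rfloor>\<bar>)"
      unfolding of_nat_sum by (intro sum.cong) (auto simp: code_def)
    also have "\<dots> \<le> (\<Sum>t<d. \<bar>v ! t\<bar> * (sqrt d / \<delta>) + 1)"
    proof (intro sum_mono)
      fix t
      have "\<bar>real_of_int \<lfloor>v ! t * sqrt d / \<delta>\<rfloor>\<bar> \<le> \<bar>v ! t * sqrt d / \<delta>\<bar> + 1" by linarith
      also have "\<bar>v ! t * sqrt d / \<delta>\<bar> = \<bar>v ! t\<bar> * (sqrt d / \<delta>)"
        using dpos by (simp add: abs_mult abs_divide)
      finally show "\<bar>real_of_int \<lfloor>v ! t * sqrt d / \<delta>\<rfloor>\<bar> \<le> \<bar>v ! t\<bar> * (sqrt d / \<delta>) + 1" .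
    qed
    also have "\<dots> = (\<Sum>t<d. \<bar>v ! t\<bar>) * (sqrt d / \<delta>) + d"
      unfolding sum.distrib sum_distrib_right by simp
    also have "\<dots> \<le> sqrt d * (sqrt d / \<delta>) + d"
      using l1 dpos by (intro add_mono mult_right_mono) auto
    also have "\<dots> \<le> real B" by (simp add: \<delta>_def B_def M_def algebra_simps)
    finally have sB: "(\<Sum>t<d. nat \<bar>code v t\<bar>) \<le> B" by linarith
    have "nat \<bar>code v t\<bar> \<le> B" if "t < d" for t
      using member_le_sum[of t "{..<d}" "\<lambda>t. nat \<bar>code v t\<bar>"] that sB by simp
    then have "\<forall>t<d. code v t \<in> {-int B..int B}" by fastforce
    then show ?thesis using sB by (auto simp: C_def code_def PiE_iff extensional_def)
  qed
  have close: "\<bar>edist x v - edist x w\<bar> \<le> \<delta>"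
    if v: "in_unit_ball d v" and w: "in_unit_ball d w" and eq: "code v = code w" and x: "length x = d" for v w x
  proof -
    have lv: "length v = d" "length w = d" using v w by (auto simp: in_unit_ball_def)
    have "(v ! t - w ! t)\<^sup>2 \<le> (\<delta> / sqrt d)\<^sup>2" if "t < d" for t
    proof -
      have "\<lfloor>v ! t * sqrt d / \<delta>\<rfloor> = \<lfloor>w ! t * sqrt d / \<delta>\<rfloor>"
        using fun_cong[OF eq, of t] that by (simp add: code_def)
      then have "\<bar>v ! t * sqrt d / \<delta> - w ! t * sqrt d / \<delta>\<bar> \<le> 1" by linarith
      then have "\<bar>(v ! t - w ! t) * (sqrt d / \<delta>)\<bar> \<le> 1" by (simp add: algebra_simps)
      then have "\<bar>v ! t - w ! t\<bar> * (sqrt d / \<delta>) \<le> 1" using dpos by (simp add: abs_mult)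
      then have "\<bar>v ! t - w ! t\<bar> \<le> \<delta> / sqrt d" using dpos d by (simp add: field_simps)
      then show ?thesis using dpos d by (simp add: abs_le_square_iff[symmetric] abs_divide)
    qed
    then have "(\<Sum>t<d. (v ! t - w ! t)\<^sup>2) \<le> (\<Sum>t<d. (\<delta> / sqrt d)\<^sup>2)" by (intro sum_mono) auto
    also have "\<dots> = \<delta>\<^sup>2" using d by (simp add: power_divide)
    finally have "edist v w \<le> \<delta>" using lv dpos
      by (simp add: edist_eq_L2_set L2_set_def real_le_lsqrt)
    then show ?thesis
      using edist_triangle[of x d v w] edist_triangle[of x d w v] edist_commute[of v d w] lv x by linarith
  qed
  \<comment> \<open>This choice balances the two factors: \<open>(1 / x)^M = (1 + 1 / M)^M\<close>
    stays below e, while \<open>2 / (1 - x) = 2 * (M + 1)\<close>.\<close>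
  define x :: real where "x = real M / (real M + 1)"
  have M: "real M \<ge> 1" by (simp add: M_def)
  have x: "0 < x" "x < 1" using M by (auto simp: x_def)
  have "finite C" unfolding C_def
    by (rule finite_subset[of _ "{..<d} \<rightarrow>\<^sub>E {-int B..int B}"]) (auto intro!: finite_PiE)
  have "real (card C) * x ^ B \<le> (2 / (1 - x)) ^ d"
    using card_int_vectors_l1_le[OF x, of C d B] unfolding C_def by blast
  also have "2 / (1 - x) = 2 * (real M + 1)" using M by (simp add: x_def field_simps)
  finally have "real (card C) \<le> (1 / x) ^ B * (2 * (real M + 1)) ^ d"
    using x by (simp add: power_divide field_simps)
  also have "1 / x = 1 + 1 / real M" using M by (simp add: x_def field_simps)
  also have "(1 + 1 / real M) ^ B = ((1 + 1 / real M) ^ M) ^ d"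
    by (simp add: B_def power_mult[symmetric] mult.commute)
  also have "\<dots> \<le> 4 ^ d"
  proof (intro power_mono)
    have "(1 + 1 / real M) ^ M \<le> exp (1 / real M) ^ M" using M by (intro power_mono exp_ge_add_one_self) auto
    also have "\<dots> = exp 1" using M by (simp add: exp_of_nat_mult[symmetric])
    also have "\<dots> \<le> 4" using exp_le by linarith
    finally show "(1 + 1 / real M) ^ M \<le> 4" .
  qed (use M in auto)
  also have "4 ^ d * (2 * (real M + 1)) ^ d = (8 * (real M + 1)) ^ d"
    by (simp add: power_mult_distrib[symmetric])
  also have "\<dots> \<le> (2 ^ (j + 5)) ^ d"
  proof (intro power_mono)
    \<comment> \<open>Used with \<open>y = 2^j\<close>; the factor 32 is the source of the 5 in the
      exponent \<open>j + 5\<close>.\<close>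
    have gen: "8 * (y + 1 + 1) \<le> 32 * y" if "1 \<le> y" for y :: real using that by simp
    have "8 * (real M + 1) = 8 * (2 ^ j + 1 + 1)" by (simp add: M_def)
    also have "\<dots> \<le> 32 * 2 ^ j" by (rule gen) simp
    finally show "8 * (real M + 1) \<le> 2 ^ (j + 5)" by (simp add: power_add)
  qed (use M in auto)
  finally have "real (card C) \<le> real (2 ^ ((j + 5) * d))"
    by (simp add: power_mult[symmetric])
  moreover have "(4::real) ^ d * (2 * (real M + 1)) ^ d \<ge> 0" by simp
  ultimately have "card C \<le> 2 ^ ((j + 5) * d)" by linarith
  then show ?thesis using that[of C code] \<open>finite C\<close> inC close unfolding \<delta>_def by blast
qed

section \<open>Lipschitz continuity of k-DTW\<close>

definition topk :: "nat \<Rightarrow> real list \<Rightarrow> real" where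
  "topk k xs = sum_list (take k (rev (sort xs)))"

lemma kdtw_eq_topk:
  "kdtw k \<sigma> \<tau> = (INF T \<in> {T. traversal (length \<sigma>) (length \<tau>) T}. topk k (matched_dists \<sigma> \<tau> T))"
  by (simp add: kdtw_def topk_def)

lemma sum_list_rev_sort:
  fixes f :: "real \<Rightarrow> real"
  shows "(\<Sum>x\<leftarrow>rev (sort xs). f x) = (\<Sum>x\<leftarrow>xs. f x)"
  by (metis mset_map mset_rev mset_sort sum_mset_sum_list)

text \<open>The sum of the \<open>k\<close> largest entries equals the minimum over \<open>t \<ge> 0\<close> of
  \<open>k t + \<Sum> max 0 (x - t)\<close>, which makes its Lipschitz continuity evident.\<close>

lemma topk_le_threshold:
  assumes "t \<ge> 0"
  shows "topk k xs \<le> k * t + (\<Sum>x\<leftarrow>xs. max 0 (x - t))"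
proof -
  define L where "L = rev (sort xs)"
  have "sum_list (take k L) \<le> (\<Sum>x\<leftarrow>take k L. t + max 0 (x - t))"
    using sum_list_mono[of "take k L" "\<lambda>x. x" "\<lambda>x. t + max 0 (x - t)"] by simp
  also have "\<dots> = length (take k L) * t + (\<Sum>x\<leftarrow>take k L. max 0 (x - t))"
    by (simp add: sum_list_addf sum_list_triv)
  also have "\<dots> \<le> k * t + ((\<Sum>x\<leftarrow>take k L. max 0 (x - t)) + (\<Sum>x\<leftarrow>drop k L. max 0 (x - t)))"
  proof (intro add_mono mult_right_mono)
    have "(\<Sum>x\<leftarrow>drop k L. max 0 (x - t)) \<ge> 0" by (intro sum_list_nonneg) auto
    then show "(\<Sum>x\<leftarrow>take k L. max 0 (x - t)) \<le> (\<Sum>x\<leftarrow>take k L. max 0 (x - t)) + (\<Sum>x\<leftarrow>drop k L. max 0 (x - t))"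
      by simp
  qed (use assms in auto)
  also have "(\<Sum>x\<leftarrow>take k L. max 0 (x - t)) + (\<Sum>x\<leftarrow>drop k L. max 0 (x - t)) = (\<Sum>x\<leftarrow>L. max 0 (x - t))"
    by (metis append_take_drop_id map_append sum_list_append)
  also have "\<dots> = (\<Sum>x\<leftarrow>xs. max 0 (x - t))"
    unfolding L_def by (rule sum_list_rev_sort)
  finally show ?thesis by (simp add: topk_def L_def)
qed

text \<open>The minimising threshold is the (k+1)-st largest entry, or 0 if there is none: entries
  before it have nonnegative excess and all later ones vanish. Nonnegativity of the entries makes
  the threshold nonnegative.\<close>

lemma topk_threshold_attained:
  assumes nn: "\<And>x. x \<in> set xs \<Longrightarrow> x \<ge> 0"
  shows "\<exists>t\<ge>0. topk k xs = k * t + (\<Sum>x\<leftarrow>xs. max 0 (x - t))"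
proof -
  define L where "L = rev (sort xs)"
  have setL: "set L = set xs" by (simp add: L_def)
  show ?thesis
  proof (cases "length xs \<le> k")
    case True
    then have "topk k xs = (\<Sum>x\<leftarrow>L. x)" by (simp add: topk_def L_def)
    also have "\<dots> = (\<Sum>x\<leftarrow>xs. x)" unfolding L_def by (rule sum_list_rev_sort)
    also have "\<dots> = (\<Sum>x\<leftarrow>xs. max 0 (x - 0))"
      by (intro arg_cong[where f = sum_list] map_cong) (auto dest: nn)
    finally show ?thesis by (intro exI[of _ 0]) simp
  next
    case False
    \<comment> \<open>Indices start at 0, so this is the first entry outside the top
      \<open>k\<close>.\<close>
    define t where "t = L ! k"
    have k: "k < length L" using False by (simp add: L_def)
    have sorted: "L ! j \<le> L ! i" if "i \<le> j" "j < length L" for i j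
      using that sorted_rev_nth_mono[of L i j] by (simp add: L_def)
    have t0: "t \<ge> 0" using nn k nth_mem[of k L] setL by (simp add: t_def)
    have up: "x \<ge> t" if "x \<in> set (take k L)" for x
      using that sorted k by (auto simp: in_set_conv_nth t_def)
    have lo: "x \<le> t" if "x \<in> set (drop k L)" for x
      using that sorted k by (auto simp: in_set_conv_nth t_def)
    have "(\<Sum>x\<leftarrow>xs. max 0 (x - t)) = (\<Sum>x\<leftarrow>L. max 0 (x - t))"
      unfolding L_def by (rule sum_list_rev_sort[symmetric])
    also have "\<dots> = (\<Sum>x\<leftarrow>take k L. max 0 (x - t)) + (\<Sum>x\<leftarrow>drop k L. max 0 (x - t))"
      by (metis append_take_drop_id map_append sum_list_append)
    also have "(\<Sum>x\<leftarrow>drop k L. max 0 (x - t)) = (\<Sum>x\<leftarrow>drop k L. 0)"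
      by (intro arg_cong[where f = sum_list] map_cong) (auto dest: lo)
    also have "(\<Sum>x\<leftarrow>take k L. max 0 (x - t)) = (\<Sum>x\<leftarrow>take k L. x - t)"
      by (intro arg_cong[where f = sum_list] map_cong) (auto dest: up)
    also have "\<dots> = topk k xs - k * t"
      using k by (simp add: sum_list_subtractf sum_list_triv topk_def L_def)
    finally show ?thesis using t0 by (intro exI[of _ t]) (simp add: sum_list_triv)
  qed
qed

text \<open>If \<open>t\<close> is optimal for \<open>g\<close>, use the threshold \<open>t\<close>
  + \<delta> for \<open>f\<close>: no excess term grows, and only \<open>k * t\<close> rises, by
  \<open>k\<close> times \<delta>. The loss is therefore independent of the length of the
  list.\<close>

lemma topk_le_add:
  assumes "\<And>e. e \<in> set es \<Longrightarrow> g e \<ge> 0" and "\<And>e. e \<in> set es \<Longrightarrow> f e \<le> g e + \<delta>" and "\<delta> \<ge> 0"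
  shows "topk k (map f es) \<le> topk k (map g es) + k * \<delta>"
proof -
  obtain t :: real where t: "t \<ge> 0" "topk k (map g es) = k * t + (\<Sum>x\<leftarrow>map g es. max 0 (x - t))"
    using topk_threshold_attained[of "map g es" k] assms by auto
  have "topk k (map f es) \<le> k * (t + \<delta>) + (\<Sum>x\<leftarrow>map f es. max 0 (x - (t + \<delta>)))"
    using t assms by (intro topk_le_threshold) auto
  also have "(\<Sum>x\<leftarrow>map f es. max 0 (x - (t + \<delta>))) \<le> (\<Sum>x\<leftarrow>map g es. max 0 (x - t))"
    unfolding map_map o_def using assms by (intro sum_list_mono) force
  finally show ?thesis using t by (simp add: algebra_simps)
qed

lemma topk_nonneg:
  assumes "\<And>x. x \<in> set xs \<Longrightarrow> x \<ge> 0"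
  shows "topk k xs \<ge> 0"
  unfolding topk_def using assms by (intro sum_list_nonneg) (auto dest: in_set_takeD)

lemma topk_all:
  assumes "length xs \<le> k"
  shows "topk k xs = sum_list xs"
  using assms sum_list_rev_sort[of "\<lambda>x. x" xs] by (simp add: topk_def)

section \<open>Traversals\<close>

text \<open>Each step raises the sum of the two indices by at least one; the last conjunct
  accumulates this and yields the length bound.\<close>

lemma traversal_mono:
  assumes "traversal m1 m2 T" "a \<le> b" "b < length T"
  shows "fst (T ! a) \<le> fst (T ! b) \<and> snd (T ! a) \<le> snd (T ! b) \<and>
    fst (T ! a) + snd (T ! a) + (b - a) \<le> fst (T ! b) + snd (T ! b)"
  using assms(2,3)
proof (induction b rule: dec_induct)
  case (step b)
  then have "trav_step (T ! b) (T ! (b + 1))" using assms(1) by (simp add: traversal_def)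
  then have "fst (T ! b) \<le> fst (T ! Suc b)" "snd (T ! b) \<le> snd (T ! Suc b)"
    "fst (T ! b) + snd (T ! b) + 1 \<le> fst (T ! Suc b) + snd (T ! Suc b)"
    by (auto simp: trav_step_def)
  with step show ?case by auto
qed simp

lemma traversal_last_nth:
  assumes "traversal m1 m2 T"
  shows "length T \<noteq> 0" "T ! (length T - 1) = (m1 - 1, m2 - 1)"
  using assms by (auto simp: traversal_def last_conv_nth)

lemma traversal_set:
  assumes "traversal m1 m2 T" "(i, j) \<in> set T"
  shows "i \<le> m1 - 1 \<and> j \<le> m2 - 1"
proof -
  obtain a where a: "a < length T" "T ! a = (i, j)" using assms(2) by (auto simp: in_set_conv_nth)
  show ?thesis
    using traversal_mono[OF assms(1), of a "length T - 1"] traversal_last_nth[OF assms(1)] a by simp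
qed

text \<open>The summand +1 keeps the bound valid for empty curves, where the truncated subtraction
  \<open>m1 - 1\<close> is 0.\<close>

lemma traversal_length:
  assumes "traversal m1 m2 T"
  shows "length T \<le> m1 + m2 + 1"
proof -
  have "length T - 1 \<le> m1 - 1 + (m2 - 1)"
    using traversal_mono[OF assms, of 0 "length T - 1"] traversal_last_nth[OF assms]
    by (simp add: le_diff_conv)
  then show ?thesis by linarith
qed

text \<open>Shows that the infimum defining the distances runs over a nonempty set, and serves as
  the witness for their upper bound.\<close>

lemma traversal_diagonal:
  assumes "m \<ge> 1"
  shows "traversal m m (map (\<lambda>i. (i, i)) [0..<m])"
  using assms by (auto simp: traversal_def trav_step_def hd_map last_map)

lemma matched_dists_nonneg: "x \<in> set (matched_dists \<sigma> \<tau> T) \<Longrightarrow> x \<ge> 0"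
  by (auto simp: matched_dists_def edist_nonneg)

section \<open>Lipschitz and boundedness properties of k-DTW\<close>

lemma kdtw_le_add:
  assumes m: "m \<ge> 1" "length \<sigma> = m" "length \<psi> = m" "length \<phi> = m" and "\<delta> \<ge> 0"
    and le: "\<And>i j. i < m \<Longrightarrow> j < m \<Longrightarrow> edist (\<sigma> ! i) (\<psi> ! j) \<le> edist (\<sigma> ! i) (\<phi> ! j) + \<delta>"
  shows "kdtw k \<sigma> \<psi> \<le> kdtw k \<sigma> \<phi> + k * \<delta>"
proof -
  \<comment> \<open>A real-valued \<open>INF\<close> can be compared with its members only over a
    nonempty set that is bounded below, so both facts are secured first.\<close>
  let ?T = "{T. traversal m m T}"
  have ne: "?T \<noteq> {}" using traversal_diagonal[OF m(1)] by blast
  have bdd: "bdd_below ((\<lambda>T. topk k (matched_dists \<sigma> \<psi> T)) ` ?T)"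
    by (intro bdd_belowI2[where m = 0] topk_nonneg matched_dists_nonneg)
  have "kdtw k \<sigma> \<psi> - k * \<delta> \<le> topk k (matched_dists \<sigma> \<phi> T)" if T: "T \<in> ?T" for T
  proof -
    have "kdtw k \<sigma> \<psi> \<le> topk k (matched_dists \<sigma> \<psi> T)"
      unfolding kdtw_eq_topk m using bdd T by (rule cINF_lower)
    also have "\<dots> \<le> topk k (matched_dists \<sigma> \<phi> T) + k * \<delta>"
      unfolding matched_dists_def
    proof (intro topk_le_add)
      fix e assume e: "e \<in> set T"
      obtain i j where ij: "e = (i, j)" by force
      have "i < m" "j < m" using traversal_set[of m m T i j] T e m(1) ij by auto
      then show "(case e of (i, j) \<Rightarrow> edist (\<sigma> ! i) (\<psi> ! j)) \<le> (case e of (i, j) \<Rightarrow> edist (\<sigma> ! i) (\<phi> ! j)) + \<delta>"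
        using le ij by simp
    qed (auto simp: edist_nonneg \<open>\<delta> \<ge> 0\<close>)
    finally show ?thesis by simp
  qed
  then have "kdtw k \<sigma> \<psi> - k * \<delta> \<le> kdtw k \<sigma> \<phi>"
    unfolding kdtw_eq_topk[of k \<sigma> \<phi>] m by (intro cINF_greatest ne)
  then show ?thesis by simp
qed

lemma kdtw_lipschitz:
  assumes m: "m \<ge> 1" "length \<sigma> = m" "length \<psi> = m" "length \<phi> = m" and "\<delta> \<ge> 0"
    and le: "\<And>i j. i < m \<Longrightarrow> j < m \<Longrightarrow> \<bar>edist (\<sigma> ! i) (\<psi> ! j) - edist (\<sigma> ! i) (\<phi> ! j)\<bar> \<le> \<delta>"
  shows "\<bar>kdtw k \<sigma> \<psi> - kdtw k \<sigma> \<phi>\<bar> \<le> k * \<delta>"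
proof -
  have "edist (\<sigma> ! i) (\<psi> ! j) \<le> edist (\<sigma> ! i) (\<phi> ! j) + \<delta>"
    "edist (\<sigma> ! i) (\<phi> ! j) \<le> edist (\<sigma> ! i) (\<psi> ! j) + \<delta>" if "i < m" "j < m" for i j
    using le[OF that] by auto
  then show ?thesis using kdtw_le_add[of m \<sigma> \<psi> \<phi> \<delta> k] kdtw_le_add[of m \<sigma> \<phi> \<psi> \<delta> k] assms by force
qed

lemma kdtw_bounds:
  assumes m: "m \<ge> 1" and \<sigma>: "\<sigma> \<in> curves_in_ball d m" and \<psi>: "\<psi> \<in> curves_in_ball d m"
  shows "\<bar>kdtw k \<sigma> \<psi>\<bar> \<le> 2 * real k"
proof -
  have len: "length \<sigma> = m" "length \<psi> = m" using \<sigma> \<psi> by (auto simp: curves_in_ball_def)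
  let ?T = "{T. traversal m m T}"
  have D: "map (\<lambda>i. (i, i)) [0..<m] \<in> ?T" using traversal_diagonal[OF m(1)] by blast
  have bdd: "bdd_below ((\<lambda>T. topk k (matched_dists \<sigma> \<psi> T)) ` ?T)"
    by (intro bdd_belowI2[where m = 0] topk_nonneg matched_dists_nonneg)
  have "kdtw k \<sigma> \<psi> \<ge> 0"
    unfolding kdtw_eq_topk len using D
    by (intro cINF_greatest topk_nonneg matched_dists_nonneg) auto
  moreover have "kdtw k \<sigma> \<psi> \<le> topk k (matched_dists \<sigma> \<psi> (map (\<lambda>i. (i, i)) [0..<m]))"
    unfolding kdtw_eq_topk len using bdd D by (rule cINF_lower)
  \<comment> \<open>The threshold 2 is the diameter of the ball, so all excess terms vanish.\<close>
  moreover have "\<dots> \<le> real k * 2 + (\<Sum>x\<leftarrow>matched_dists \<sigma> \<psi> (map (\<lambda>i. (i, i)) [0..<m]). max 0 (x - 2))"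
    by (rule topk_le_threshold) simp
  moreover have "(\<Sum>x\<leftarrow>matched_dists \<sigma> \<psi> (map (\<lambda>i. (i, i)) [0..<m]). max 0 (x - 2)) =
      (\<Sum>x\<leftarrow>matched_dists \<sigma> \<psi> (map (\<lambda>i. (i, i)) [0..<m]). 0)"
  proof (intro arg_cong[where f = sum_list] map_cong)
    fix x assume "x \<in> set (matched_dists \<sigma> \<psi> (map (\<lambda>i. (i, i)) [0..<m]))"
    then obtain i where "i < m" "x = edist (\<sigma> ! i) (\<psi> ! i)" by (auto simp: matched_dists_def)
    then have "x \<le> 2" using edist_le_2[of d "\<sigma> ! i" "\<psi> ! i"] \<sigma> \<psi> by (auto simp: curves_in_ball_def)
    then show "max 0 (x - 2) = 0" by simp
  qed simp
  ultimately show ?thesis by (simp add: sum_list_triv)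
qed

text \<open>Once \<open>k\<close> is at least the length of every traversal, the
  top-\<open>k\<close> sum is the whole sum; DTW thus inherits everything proved for k-DTW.\<close>

lemma dtw_eq_kdtw:
  assumes "length \<sigma> + length \<tau> + 1 \<le> k"
  shows "dtw \<sigma> \<tau> = kdtw k \<sigma> \<tau>"
  unfolding dtw_def kdtw_eq_topk
proof (intro INF_cong refl)
  fix T assume "T \<in> {T. traversal (length \<sigma>) (length \<tau>) T}"
  then have "length (matched_dists \<sigma> \<tau> T) \<le> k"
    using traversal_length[of "length \<sigma>" "length \<tau>" T] assms by (simp add: matched_dists_def)
  then show "sum_list (matched_dists \<sigma> \<tau> T) = topk k (matched_dists \<sigma> \<tau> T)" by (simp add: topk_all)
qed

section \<open>Nets for the curve space\<close>

definition sup_net :: "nat \<Rightarrow> ('a \<Rightarrow> nat \<Rightarrow> real) \<Rightarrow> 'a set \<Rightarrow> real \<Rightarrow> 'a set \<Rightarrow> bool" where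
  "sup_net n f S r A \<longleftrightarrow> finite A \<and> A \<subseteq> S \<and> (\<forall>x\<in>S. \<exists>a\<in>A. \<forall>i<n. \<bar>f x i - f a i\<bar> \<le> r)"

text \<open>One representative is chosen from each nonempty fibre of the code. The centres therefore
  lie in \<open>S\<close>, and the radius is not doubled.\<close>

lemma sup_net_of_code:
  assumes "finite C" "\<And>x. x \<in> S \<Longrightarrow> c x \<in> C"
    and "\<And>x y i. x \<in> S \<Longrightarrow> y \<in> S \<Longrightarrow> c x = c y \<Longrightarrow> i < n \<Longrightarrow> \<bar>f x i - f y i\<bar> \<le> r"
  shows "\<exists>A. sup_net n f S r A \<and> card A \<le> card C"
proof -
  let ?A = "inv_into S c ` (c ` S)"
  have sub: "c ` S \<subseteq> C" using assms by auto
  then have fin: "finite (c ` S)" using assms finite_subset by blast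
  have "card ?A \<le> card (c ` S)" using fin by (rule card_image_le)
  also have "\<dots> \<le> card C" using assms sub by (intro card_mono)
  finally have card: "card ?A \<le> card C" .
  have "\<exists>a\<in>?A. \<forall>i<n. \<bar>f x i - f a i\<bar> \<le> r" if "x \<in> S" for x
    using that assms(3)[of x "inv_into S c (c x)"]
    by (intro bexI[of _ "inv_into S c (c x)"]) (auto simp: inv_into_into f_inv_into_f)
  with fin card show ?thesis
    by (intro exI[of _ ?A]) (auto simp: sup_net_def inv_into_into)
qed

text \<open>A curve is coded vertex by vertex, whence the power \<open>m\<close>. Equal codes change
  each vertex distance by at most \<delta>, hence each k-DTW value by at most \<open>k\<close> times
  \<delta>.\<close>

lemma kdtw_net_of_vertex_code:
  assumes "m \<ge> 1" "\<And>i. i < n \<Longrightarrow> P i \<in> curves_in_ball d m" "\<delta> \<ge> 0"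
    and C: "finite C" "\<And>v. in_unit_ball d v \<Longrightarrow> code v \<in> C"
    and close: "\<And>v w i l. in_unit_ball d v \<Longrightarrow> in_unit_ball d w \<Longrightarrow> code v = code w \<Longrightarrow> i < n \<Longrightarrow> l < m \<Longrightarrow>
       \<bar>edist (P i ! l) v - edist (P i ! l) w\<bar> \<le> \<delta>"
  shows "\<exists>A. sup_net n (\<lambda>\<psi> i. kdtw k (P i) \<psi>) (curves_in_ball d m) (k * \<delta>) A \<and> card A \<le> card C ^ m"
proof -
  let ?D = "{xs. set xs \<subseteq> C \<and> length xs = m}"
  have "\<exists>A. sup_net n (\<lambda>\<psi> i. kdtw k (P i) \<psi>) (curves_in_ball d m) (k * \<delta>) A \<and> card A \<le> card ?D"
  proof (rule sup_net_of_code[where c = "map code"])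
    show "finite ?D" using C by (intro finite_lists_length_eq)
    show "map code x \<in> ?D" if "x \<in> curves_in_ball d m" for x
      using that C by (auto simp: curves_in_ball_def)
    fix x y i assume x: "x \<in> curves_in_ball d m" and y: "y \<in> curves_in_ball d m"
      and eq: "map code x = map code y" and i: "i < n"
    have len: "length x = m" "length y = m" "length (P i) = m"
      using x y assms(2)[OF i] by (auto simp: curves_in_ball_def)
    show "\<bar>kdtw k (P i) x - kdtw k (P i) y\<bar> \<le> k * \<delta>"
    proof (rule kdtw_lipschitz[where m = m])
      fix l j assume lj: "l < m" "j < m"
      have "code (x ! j) = code (y ! j)" using arg_cong[OF eq, of "\<lambda>z. z ! j"] lj len by simp
      moreover have "in_unit_ball d (x ! j)" "in_unit_ball d (y ! j)"
        using x y lj len by (auto simp: curves_in_ball_def)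
      ultimately show "\<bar>edist (P i ! l) (x ! j) - edist (P i ! l) (y ! j)\<bar> \<le> \<delta>"
        using close i lj by blast
    qed (use len assms in auto)
  qed
  then show ?thesis using C by (simp add: card_lists_length_eq)
qed

lemma kdtw_net_grid:
  assumes "d \<ge> 1" "m \<ge> 1" "\<And>i. i < n \<Longrightarrow> P i \<in> curves_in_ball d m"
  shows "\<exists>A. sup_net n (\<lambda>\<psi> i. kdtw k (P i) \<psi>) (curves_in_ball d m) (k * (2 / 2 ^ j)) A \<and>
    card A \<le> 2 ^ ((j + 5) * d * m)"
proof -
  obtain code :: "point \<Rightarrow> nat \<Rightarrow> int" and C where C: "finite C" "card C \<le> 2 ^ ((j + 5) * d)"
    "\<And>v. in_unit_ball d v \<Longrightarrow> code v \<in> C"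
    "\<And>v w x. in_unit_ball d v \<Longrightarrow> in_unit_ball d w \<Longrightarrow> code v = code w \<Longrightarrow> length x = d \<Longrightarrow>
       \<bar>edist x v - edist x w\<bar> \<le> 2 / 2 ^ j"
    using distance_code_grid[OF assms(1)] by metis
  have "length (P i ! l) = d" if "i < n" "l < m" for i l
    using assms(3)[OF that(1)] that by (auto simp: curves_in_ball_def in_unit_ball_def)
  then obtain A where A: "sup_net n (\<lambda>\<psi> i. kdtw k (P i) \<psi>) (curves_in_ball d m) (k * (2 / 2 ^ j)) A"
     "card A \<le> card C ^ m"
    using kdtw_net_of_vertex_code[of m n P d "2 / 2 ^ j" C code k] assms C by auto
  have "card C ^ m \<le> (2 ^ ((j + 5) * d)) ^ m" using C by (intro power_mono) auto
  then show ?thesis using A le_trans unfolding power_mult[symmetric] by blast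
qed

lemma kdtw_net_dimension_free:
  assumes "m \<ge> 2" "n \<ge> 1" "\<And>i. i < n \<Longrightarrow> P i \<in> curves_in_ball d m"
  shows "\<exists>A. sup_net n (\<lambda>\<psi> i. kdtw k (P i) \<psi>) (curves_in_ball d m) (k * (2 / 2 ^ j)) A \<and>
    card A \<le> (m * n) ^ (79 * 4 ^ j * m)"
proof -
  define I where "I = {..<n} \<times> {..<m}"
  define N where "N = m * n"
  have cardI: "card I = N" by (simp add: I_def N_def card_cartesian_product)
  have N: "N \<ge> 2" using assms(1,2) mult_le_mono[of 2 m 1 n] by (simp add: N_def)
  have pow4: "(2::real) ^ j * 2 ^ j = 4 ^ j" by (simp add: power_mult_distrib[symmetric])
  have I: "finite I" "I \<noteq> {}" using assms(1,2) by (auto simp: I_def lessThan_empty_iff)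
  obtain code :: "point \<Rightarrow> (nat \<times> nat) \<times> nat \<times> (real \<times> nat \<times> nat) list" and C where C: "finite C"
    "card C \<le> card I * ((5 * 2 ^ j + 1) * (2 * card I + 1) ^ (25 * 4 ^ j))"
    "\<And>v. in_unit_ball d v \<Longrightarrow> code v \<in> C"
    "\<And>v w i. in_unit_ball d v \<Longrightarrow> in_unit_ball d w \<Longrightarrow> code v = code w \<Longrightarrow> i \<in> I \<Longrightarrow>
       \<bar>edist (case i of (a, b) \<Rightarrow> P a ! b) v - edist (case i of (a, b) \<Rightarrow> P a ! b) w\<bar> \<le> 5 * (2 / 2 ^ j / 5)"
  \<comment> \<open>With \<epsilon> equal to a fifth of the target radius \<open>2 / 2^j\<close>,
    the conditions on \<open>K\<close> and \<open>Z\<close> hold with equality for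
    \<open>25 * 4^j\<close> and \<open>5 * 2^j\<close>.\<close>
  proof (rule distance_code_dimension_free[OF I, of d "\<lambda>(a, b). P a ! b" "2 / 2 ^ j / 5" "25 * 4 ^ j" "5 * 2 ^ j"])
    show "in_unit_ball d (case i of (a, b) \<Rightarrow> P a ! b)" if "i \<in> I" for i
      using that assms(3) by (force simp: I_def curves_in_ball_def)
    show "4 \<le> real (25 * 4 ^ j) * (2 / 2 ^ j / 5)\<^sup>2" by (simp add: power2_eq_square pow4)
  qed auto
  have "\<bar>edist (P i ! l) v - edist (P i ! l) w\<bar> \<le> 2 / 2 ^ j"
    if "in_unit_ball d v" "in_unit_ball d w" "code v = code w" "i < n" "l < m" for v w i l
    using C(4)[OF that(1-3), of "(i, l)"] that by (simp add: I_def)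
  then obtain A where A: "sup_net n (\<lambda>\<psi> i. kdtw k (P i) \<psi>) (curves_in_ball d m) (k * (2 / 2 ^ j)) A"
     "card A \<le> card C ^ m"
    using kdtw_net_of_vertex_code[of m n P d "2 / 2 ^ j" C code k] assms C by auto
  have "card C \<le> N * ((5 * 2 ^ j + 1) * (2 * N + 1) ^ (25 * 4 ^ j))" using C(2) cardI by simp
  \<comment> \<open>Each factor is absorbed into a power of \<open>N\<close>, which is possible as
    \<open>N \<ge> 2\<close>; the exponents 1, 3 and 3 * 25 add up to 79, times
    \<open>4^j\<close>.\<close>
  also have "\<dots> \<le> N ^ 4 ^ j * (N ^ (3 * 4 ^ j) * (N ^ 3) ^ (25 * 4 ^ j))"
  proof (intro mult_le_mono power_mono)
    show "N \<le> N ^ 4 ^ j" using N by (intro self_le_power) auto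
    have "5 * 2 ^ j + 1 \<le> (2::nat) ^ (j + 3)" by (simp add: power_add)
    also have "\<dots> \<le> 2 ^ (3 * 4 ^ j)"
    proof (intro power_increasing)
      show "j + 3 \<le> 3 * 4 ^ j" by (induction j) auto
    qed simp
    also have "\<dots> \<le> N ^ (3 * 4 ^ j)" using N by (intro power_mono) auto
    finally show "5 * 2 ^ j + 1 \<le> N ^ (3 * 4 ^ j)" .
    have "2 * N + 1 \<le> 4 * N" using N by simp
    also have "\<dots> \<le> (N * N) * N" using N mult_le_mono[OF N N] by (intro mult_le_mono) auto
    finally show "2 * N + 1 \<le> N ^ 3" by (simp add: power3_eq_cube)
  qed auto
  also have "\<dots> = N ^ (79 * 4 ^ j)"
    by (simp add: power_mult[symmetric] power_add[symmetric])
  finally have "card C ^ m \<le> (N ^ (79 * 4 ^ j)) ^ m" by (intro power_mono) auto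
  then show ?thesis using A le_trans unfolding power_mult[symmetric] N_def by blast
qed

section \<open>Chaining for subgaussian families\<close>

text \<open>The moment generating function of linear combinations is all that chaining uses of
  Rademacher and Gaussian variables, so both are treated at once; independence enters only when the
  locale is instantiated. Integrability is required separately because the Bochner integral of a
  non-integrable function is 0.\<close>

locale subgaussian_family = prob_space M for M :: "'a measure" +
  fixes n :: nat and X :: "nat \<Rightarrow> 'a \<Rightarrow> real"
  assumes measurable_X: "\<And>i. i < n \<Longrightarrow> X i \<in> borel_measurable M"
    and integrable_exp: "\<And>a. integrable M (\<lambda>\<omega>. exp (\<Sum>i<n. a i * X i \<omega>))"
    and expectation_exp: "\<And>a. expectation (\<lambda>\<omega>. exp (\<Sum>i<n. a i * X i \<omega>)) \<le> exp ((\<Sum>i<n. (a i)\<^sup>2) / 2)"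

text \<open>This is \<open>ln z \<le> z - 1\<close> at \<open>z = exp (l * |y|) / K\<close>. The
  bound is linear in the exponentials, and \<open>K\<close> remains free for optimisation.\<close>

lemma abs_le_exp_bound:
  fixes y :: real
  assumes "l > 0" "K > 0"
  shows "\<bar>y\<bar> \<le> (ln K - 1 + (exp (l * y) + exp (- l * y)) / K) / l"
proof -
  have "l * \<bar>y\<bar> = ln K + ln (exp (l * \<bar>y\<bar>) / K)" using assms by (simp add: ln_div)
  also have "\<dots> \<le> ln K + (exp (l * \<bar>y\<bar>) / K - 1)"
    using assms by (intro add_left_mono ln_le_minus_one) auto
  also have "exp (l * \<bar>y\<bar>) \<le> exp (l * y) + exp (- l * y)"
    by (cases "y \<ge> 0") (auto intro: less_imp_le add_increasing add_increasing2)
  finally show ?thesis using assms by (simp add: field_simps)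
qed

section \<open>The maximal inequality\<close>

context subgaussian_family
begin

text \<open>Taking expectations in \<open>abs_le_exp_bound\<close> replaces the usual appeal to Jensen's inequality.\<close>

lemma expectation_Max_le:
  fixes a :: "'e \<Rightarrow> nat \<Rightarrow> real" and N :: nat
  assumes E: "finite E" "E \<noteq> {}" "card E \<le> N" and s: "s > 0"
    and a: "\<And>e. e \<in> E \<Longrightarrow> (\<Sum>i<n. (a e i)\<^sup>2) \<le> s\<^sup>2"
  shows "integrable M (\<lambda>\<omega>. MAX e\<in>E. \<bar>\<Sum>i<n. a e i * X i \<omega>\<bar>)" (is "integrable M ?Z")
    and "expectation (\<lambda>\<omega>. MAX e\<in>E. \<bar>\<Sum>i<n. a e i * X i \<omega>\<bar>) \<le> s * sqrt (2 * ln (2 * real N))"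
proof -
  define Y where "Y e \<omega> = (\<Sum>i<n. a e i * X i \<omega>)" for e \<omega>
  have N: "real N \<ge> 1" using E by (metis One_nat_def card_gt_0_iff le_trans of_nat_1 of_nat_mono Suc_leI)
  define h where "h = sqrt (2 * ln (2 * real N))"
  have h: "h > 0" "h\<^sup>2 = 2 * ln (2 * real N)" using N by (auto simp: h_def)
  \<comment> \<open>This \<open>l\<close> minimises \<open>(ln (2 * N) + l^2 * s^2 / 2) / l\<close>,
    with value \<open>s * h\<close>. The \<open>K\<close> below bounds the expected sum of all 2N
    exponentials, so the quotient by \<open>K\<close> has expectation at most 1 and cancels the
    -1.\<close>
  define l where "l = h / s"
  define K where "K = 2 * N * exp (l\<^sup>2 * s\<^sup>2 / 2)"
  have l: "l > 0" and K: "K > 0" using h s N by (auto simp: l_def K_def)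
  define U where "U \<omega> = (ln K - 1 + (\<Sum>e\<in>E. exp (l * Y e \<omega>) + exp (- l * Y e \<omega>)) / K) / l" for \<omega>
  have lin: "l * Y e \<omega> = (\<Sum>i<n. (l * a e i) * X i \<omega>)" "- l * Y e \<omega> = (\<Sum>i<n. (- l * a e i) * X i \<omega>)" for e \<omega>
    by (simp_all add: Y_def sum_distrib_left mult.assoc sum_negf)
  have int: "integrable M (\<lambda>\<omega>. exp (l * Y e \<omega>))" "integrable M (\<lambda>\<omega>. exp (- l * Y e \<omega>))" for e
    unfolding lin by (intro integrable_exp)+
  have ex: "expectation (\<lambda>\<omega>. exp (l * Y e \<omega>)) \<le> exp (l\<^sup>2 * s\<^sup>2 / 2)"
    "expectation (\<lambda>\<omega>. exp (- l * Y e \<omega>)) \<le> exp (l\<^sup>2 * s\<^sup>2 / 2)" if "e \<in> E" for e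
  proof -
    have *: "(\<Sum>i<n. (l * a e i)\<^sup>2) \<le> l\<^sup>2 * s\<^sup>2" "(\<Sum>i<n. (- l * a e i)\<^sup>2) \<le> l\<^sup>2 * s\<^sup>2"
      using a[OF that] by (simp_all add: power_mult_distrib sum_distrib_left[symmetric] mult_left_mono)
    show "expectation (\<lambda>\<omega>. exp (l * Y e \<omega>)) \<le> exp (l\<^sup>2 * s\<^sup>2 / 2)"
      unfolding lin by (rule order_trans[OF expectation_exp]) (use *(1) in simp)
    show "expectation (\<lambda>\<omega>. exp (- l * Y e \<omega>)) \<le> exp (l\<^sup>2 * s\<^sup>2 / 2)"
      unfolding lin by (rule order_trans[OF expectation_exp]) (use *(2) in simp)
  qed
  have intU: "integrable M U" unfolding U_def using int by (auto intro!: Bochner_Integration.integrable_add)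
  have ZU: "?Z \<omega> \<le> U \<omega>" for \<omega>
  proof -
    have "?Z \<omega> \<in> (\<lambda>e. \<bar>Y e \<omega>\<bar>) ` E" unfolding Y_def using E by (intro Max_in) auto
    then obtain e where e: "e \<in> E" "?Z \<omega> = \<bar>Y e \<omega>\<bar>" by blast
    have "?Z \<omega> \<le> (ln K - 1 + (exp (l * Y e \<omega>) + exp (- l * Y e \<omega>)) / K) / l"
      unfolding e(2) using l K by (rule abs_le_exp_bound)
    also have "\<dots> \<le> U \<omega>" unfolding U_def
      using member_le_sum[OF e(1), of "\<lambda>e. exp (l * Y e \<omega>) + exp (- l * Y e \<omega>)"] E l K
      by (intro divide_right_mono add_left_mono) (auto intro: add_nonneg_nonneg)
    finally show ?thesis .
  qed
  have Z0: "?Z \<omega> \<ge> 0" for \<omega> using E by (subst Max_ge_iff) auto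
  have [measurable]: "?Z \<in> borel_measurable M"
    using E measurable_X by (intro borel_measurable_Max borel_measurable_abs borel_measurable_sum borel_measurable_times) auto
  show intZ: "integrable M ?Z"
  proof (rule Bochner_Integration.integrable_bound[OF intU])
    have "norm (?Z \<omega>) \<le> norm (U \<omega>)" for \<omega> using ZU[of \<omega>] Z0[of \<omega>] unfolding real_norm_def by linarith
    then show "AE \<omega> in M. norm (?Z \<omega>) \<le> norm (U \<omega>)" by simp
  qed simp
  have "expectation ?Z \<le> expectation U" using intZ intU ZU by (intro integral_mono) auto
  also have "\<dots> = (ln K - 1 + (\<Sum>e\<in>E. expectation (\<lambda>\<omega>. exp (l * Y e \<omega>)) + expectation (\<lambda>\<omega>. exp (- l * Y e \<omega>))) / K) / l"
    unfolding U_def using int by (simp add: prob_space)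
  also have "\<dots> \<le> (ln K - 1 + (\<Sum>e\<in>E. exp (l\<^sup>2 * s\<^sup>2 / 2) + exp (l\<^sup>2 * s\<^sup>2 / 2)) / K) / l"
    using l K by (intro divide_right_mono add_left_mono sum_mono add_mono ex) auto
  also have "\<dots> = (ln K - 1 + card E * (2 * exp (l\<^sup>2 * s\<^sup>2 / 2)) / K) / l" by simp
  also have "\<dots> \<le> (ln K - 1 + N * (2 * exp (l\<^sup>2 * s\<^sup>2 / 2)) / K) / l"
    using l K E(3) by (intro divide_right_mono add_left_mono mult_right_mono) auto
  also have "N * (2 * exp (l\<^sup>2 * s\<^sup>2 / 2)) / K = 1" using N by (simp add: K_def)
  also have "ln K = ln (2 * real N) + l\<^sup>2 * s\<^sup>2 / 2" using N by (simp add: K_def ln_mult)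
  also have "l\<^sup>2 * s\<^sup>2 = h\<^sup>2" using s by (simp add: l_def power_divide)
  also have "(ln (2 * real N) + h\<^sup>2 / 2 - 1 + 1) / l = s * h"
    using h s unfolding l_def by (simp add: field_simps power2_eq_square)
  finally show "expectation ?Z \<le> s * sqrt (2 * ln (2 * real N))" by (simp add: h_def)
qed

text \<open>The maximal inequality for a single unit coefficient vector; its bound
  \<open>sqrt (2 * ln 2)\<close> is below 2.\<close>

lemma expectation_abs_X:
  assumes "i < n"
  shows "integrable M (\<lambda>\<omega>. \<bar>X i \<omega>\<bar>)" "expectation (\<lambda>\<omega>. \<bar>X i \<omega>\<bar>) \<le> 2"
proof -
  have eq: "(\<Sum>l<n. (if l = i then 1 else 0) * X l \<omega>) = X i \<omega>" for \<omega>
    using assms by (simp add: if_distrib[of "\<lambda>x. x * _"] cong: if_cong)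
  have sq: "(\<Sum>l<n. (if l = i then 1 else 0 :: real)\<^sup>2) \<le> 1\<^sup>2"
    using assms by (simp add: if_distrib[of "\<lambda>x. x\<^sup>2"] cong: if_cong)
  note E = expectation_Max_le[of "{()}" 1 1 "\<lambda>_ l. if l = i then 1 else 0", simplified eq, OF _ _ _ _ sq, simplified]
  from E(1) show "integrable M (\<lambda>\<omega>. \<bar>X i \<omega>\<bar>)" by simp
  have "sqrt (2 * ln 2) \<le> sqrt (2\<^sup>2)" using ln_2_less_1 by (intro real_sqrt_le_mono) simp
  then show "expectation (\<lambda>\<omega>. \<bar>X i \<omega>\<bar>) \<le> 2" using E(2) by simp
qed

section \<open>Empirical suprema and chaining\<close>

definition emp_sup :: "('c \<Rightarrow> nat \<Rightarrow> real) \<Rightarrow> 'c set \<Rightarrow> 'a \<Rightarrow> real" where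
  "emp_sup f S \<omega> = (SUP x\<in>S. \<bar>(1 / real n) * (\<Sum>i<n. f x i * X i \<omega>)\<bar>)"

text \<open>The price of moving to a net point: the radius times the mean of \<open>|X i|\<close>,
  whose expectation is bounded by a constant.\<close>

lemma emp_diff_le:
  assumes "\<And>i. i < n \<Longrightarrow> \<bar>u i - v i\<bar> \<le> r"
  shows "\<bar>(1 / real n) * (\<Sum>i<n. u i * X i \<omega>)\<bar> \<le>
    \<bar>(1 / real n) * (\<Sum>i<n. v i * X i \<omega>)\<bar> + r * ((1 / real n) * (\<Sum>i<n. \<bar>X i \<omega>\<bar>))"
proof -
  have "\<bar>(\<Sum>i<n. u i * X i \<omega>) - (\<Sum>i<n. v i * X i \<omega>)\<bar> = \<bar>\<Sum>i<n. (u i - v i) * X i \<omega>\<bar>"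
    by (simp add: sum_subtractf left_diff_distrib)
  also have "\<dots> \<le> (\<Sum>i<n. r * \<bar>X i \<omega>\<bar>)"
    using assms by (intro order_trans[OF sum_abs] sum_mono) (auto simp: abs_mult intro!: mult_right_mono)
  also have "\<dots> = r * (\<Sum>i<n. \<bar>X i \<omega>\<bar>)" by (simp add: sum_distrib_left)
  finally have "\<bar>\<Sum>i<n. u i * X i \<omega>\<bar> \<le> \<bar>\<Sum>i<n. v i * X i \<omega>\<bar> + r * (\<Sum>i<n. \<bar>X i \<omega>\<bar>)" by linarith
  then have "\<bar>\<Sum>i<n. u i * X i \<omega>\<bar> / n \<le> (\<bar>\<Sum>i<n. v i * X i \<omega>\<bar> + r * (\<Sum>i<n. \<bar>X i \<omega>\<bar>)) / n"
    by (rule divide_right_mono) simp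
  then show ?thesis by (simp add: abs_mult add_divide_distrib)
qed

lemma emp_abs_le:
  assumes "\<And>i. i < n \<Longrightarrow> \<bar>u i\<bar> \<le> r"
  shows "\<bar>(1 / real n) * (\<Sum>i<n. u i * X i \<omega>)\<bar> \<le> r * ((1 / real n) * (\<Sum>i<n. \<bar>X i \<omega>\<bar>))"
  using emp_diff_le[of u "\<lambda>_. 0" r \<omega>] assms by simp

text \<open>Measurability: the union of the nets is a countable index set with the same supremum.\<close>

lemma integrable_emp_sup:
  assumes S: "S \<noteq> {}" and r: "r \<ge> 0" and bnd: "\<And>x i. x \<in> S \<Longrightarrow> i < n \<Longrightarrow> \<bar>f x i\<bar> \<le> r"
    and net: "\<And>j. sup_net n f S (r / 2 ^ j) (A j)"
  shows "integrable M (emp_sup f S)"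
proof -
  define h where "h x \<omega> = \<bar>(1 / real n) * (\<Sum>i<n. f x i * X i \<omega>)\<bar>" for x \<omega>
  define W where "W \<omega> = (1 / real n) * (\<Sum>i<n. \<bar>X i \<omega>\<bar>)" for \<omega>
  define D where "D = (\<Union>j. A j)"
  have hW: "h x \<omega> \<le> r * W \<omega>" if "x \<in> S" for x \<omega>
    unfolding h_def W_def using bnd that by (intro emp_abs_le)
  have W0: "W \<omega> \<ge> 0" for \<omega> by (simp add: W_def sum_nonneg)
  have DS: "D \<subseteq> S" using net by (auto simp: D_def sup_net_def)
  have D0: "D \<noteq> {}" using net[of 0] S by (force simp: D_def sup_net_def)
  have cD: "countable D" unfolding D_def using net by (intro countable_UN) (auto simp: sup_net_def countable_finite)
  have bdd: "bdd_above ((\<lambda>x. h x \<omega>) ` T)" if "T \<subseteq> S" for T \<omega>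
    using hW that by (intro bdd_aboveI2[where M = "r * W \<omega>"]) auto
  have eq: "emp_sup f S \<omega> = (SUP x\<in>D. h x \<omega>)" for \<omega>
  proof (rule antisym)
    \<comment> \<open>Every scale offers a net point whose value falls short by at most
      \<open>r / 2^j * W\<close> at \<omega>; the claim follows in the limit of large
      \<open>j\<close>.\<close>
    have "h x \<omega> \<le> (SUP x\<in>D. h x \<omega>)" if x: "x \<in> S" for x
    proof (rule LIMSEQ_le_const)
      show "(\<lambda>j. (SUP x\<in>D. h x \<omega>) + r / 2 ^ j * W \<omega>) \<longlonglongrightarrow> (SUP x\<in>D. h x \<omega>)"
      proof -
        have "(\<lambda>j. r * W \<omega> * (1 / 2) ^ j) \<longlonglongrightarrow> r * W \<omega> * 0"
          by (intro tendsto_mult tendsto_const LIMSEQ_power_zero) auto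
        then have "(\<lambda>j. (SUP x\<in>D. h x \<omega>) + r * W \<omega> * (1 / 2) ^ j) \<longlonglongrightarrow> (SUP x\<in>D. h x \<omega>) + r * W \<omega> * 0"
          by (intro tendsto_add tendsto_const)
        then show ?thesis by (simp add: power_divide)
      qed
      have "h x \<omega> \<le> (SUP x\<in>D. h x \<omega>) + r / 2 ^ j * W \<omega>" for j
      proof -
        obtain a where a: "a \<in> A j" "\<forall>i<n. \<bar>f x i - f a i\<bar> \<le> r / 2 ^ j"
          using net[of j] x by (auto simp: sup_net_def)
        have "h x \<omega> \<le> h a \<omega> + r / 2 ^ j * W \<omega>"
          unfolding h_def W_def using a by (intro emp_diff_le) auto
        also have "h a \<omega> \<le> (SUP x\<in>D. h x \<omega>)"
          using a bdd[OF DS] by (intro cSUP_upper) (auto simp: D_def)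
        finally show ?thesis by simp
      qed
      then show "\<exists>N. \<forall>j\<ge>N. h x \<omega> \<le> (SUP x\<in>D. h x \<omega>) + r / 2 ^ j * W \<omega>" by blast
    qed
    then show "emp_sup f S \<omega> \<le> (SUP x\<in>D. h x \<omega>)"
      unfolding emp_sup_def h_def[symmetric] using S by (intro cSUP_least) auto
    show "(SUP x\<in>D. h x \<omega>) \<le> emp_sup f S \<omega>"
      unfolding emp_sup_def h_def[symmetric] using D0 DS bdd[of S] by (intro cSUP_subset_mono) auto
  qed
  have mh: "h x \<in> borel_measurable M" for x
    unfolding h_def using measurable_X
    by (intro borel_measurable_abs borel_measurable_times borel_measurable_sum borel_measurable_const) auto
  have meas: "emp_sup f S \<in> borel_measurable M"
    unfolding eq[abs_def] using mh bdd[OF DS] cD by (intro borel_measurable_cSUP) auto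
  obtain x0 where x0: "x0 \<in> S" using S by blast
  have "0 \<le> emp_sup f S \<omega>" for \<omega>
  proof -
    have "0 \<le> h x0 \<omega>" by (simp add: h_def)
    also have "\<dots> \<le> emp_sup f S \<omega>" unfolding emp_sup_def h_def[symmetric] using x0 bdd[of S] by (intro cSUP_upper) auto
    finally show ?thesis .
  qed
  moreover have "emp_sup f S \<omega> \<le> r * W \<omega>" for \<omega>
    unfolding emp_sup_def h_def[symmetric] using S hW by (intro cSUP_least) auto
  ultimately have le: "AE \<omega> in M. norm (emp_sup f S \<omega>) \<le> norm (r * W \<omega>)"
    using r W0 by (intro AE_I2) (simp add: abs_le_iff)
  have "integrable M (\<lambda>\<omega>. r * W \<omega>)"
    unfolding W_def using expectation_abs_X by (intro integrable_mult_right Bochner_Integration.integrable_sum) auto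
  then show ?thesis using meas le by (rule Bochner_Integration.integrable_bound)
qed

text \<open>Dudley chaining truncated at scale \<open>J\<close>: a telescoping sum runs through net
  points at successive scales, each link is handled by the maximal inequality over at most
  \<open>N j * N (Suc j)\<close> pairs, and the last radius leaves the remainder
  \<open>2 * r / 2^J\<close>.\<close>

lemma expectation_emp_sup_chaining:
  fixes N :: "nat \<Rightarrow> nat"
  assumes S: "S \<noteq> {}" and r: "r > 0" and n: "n \<ge> 1"
    and bnd: "\<And>x i. x \<in> S \<Longrightarrow> i < n \<Longrightarrow> \<bar>f x i\<bar> \<le> r"
    and net: "\<And>j. sup_net n f S (r / 2 ^ j) (A j)" and card: "\<And>j. card (A j) \<le> N j"
  shows "expectation (emp_sup f S) \<le> r / sqrt n * (sqrt (2 * ln (2 * real (N 0))) +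
     (\<Sum>j<J. 2 / 2 ^ j * sqrt (2 * ln (2 * (real (N j) * real (N (Suc j))))))) + 2 * r / 2 ^ J"
proof -
  define W where "W \<omega> = (1 / real n) * (\<Sum>i<n. \<bar>X i \<omega>\<bar>)" for \<omega>
  \<comment> \<open>A finite set containing every possible link, independent of the point being
    approximated; the radius \<open>2 * r / 2^j\<close> covers the two radii \<open>r / 2^j\<close>
    and \<open>r / 2^(Suc j)\<close> together.\<close>
  define E where "E j = {e \<in> A j \<times> A (Suc j). \<forall>i<n. \<bar>f (snd e) i - f (fst e) i\<bar> \<le> 2 * r / 2 ^ j}" for j
  define Z0 where "Z0 \<omega> = (MAX x\<in>A 0. \<bar>\<Sum>i<n. f x i * X i \<omega>\<bar>)" for \<omega>
  define Z where "Z j \<omega> = (MAX e\<in>E j. \<bar>\<Sum>i<n. (f (snd e) i - f (fst e) i) * X i \<omega>\<bar>)" for j \<omega>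
  have finA: "finite (A j)" "A j \<subseteq> S" for j using net[of j] by (auto simp: sup_net_def)
  have A0: "A 0 \<noteq> {}" using net[of 0] S by (force simp: sup_net_def)
  have "\<forall>j. \<forall>x\<in>S. \<exists>a\<in>A j. \<forall>i<n. \<bar>f x i - f a i\<bar> \<le> r / 2 ^ j" using net by (auto simp: sup_net_def)
  then obtain \<pi> where \<pi>: "\<And>j x. x \<in> S \<Longrightarrow> \<pi> j x \<in> A j"
    "\<And>j x i. x \<in> S \<Longrightarrow> i < n \<Longrightarrow> \<bar>f x i - f (\<pi> j x) i\<bar> \<le> r / 2 ^ j"
    by metis
  have edge: "(\<pi> j x, \<pi> (Suc j) x) \<in> E j" if x: "x \<in> S" for j x
  proof -
    have "\<bar>f (\<pi> (Suc j) x) i - f (\<pi> j x) i\<bar> \<le> 2 * r / 2 ^ j" if i: "i < n" for i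
    proof -
      have "r / 2 ^ Suc j \<le> r / 2 ^ j" using r by (intro divide_left_mono) auto
      then show ?thesis using \<pi>(2)[OF x i, of j] \<pi>(2)[OF x i, of "Suc j"] by linarith
    qed
    then show ?thesis using \<pi>(1)[OF x] by (auto simp: E_def)
  qed
  have E: "finite (E j)" "E j \<noteq> {}" "card (E j) \<le> N j * N (Suc j)" for j
  proof -
    have fin: "finite (A j \<times> A (Suc j))" using finA by blast
    show "finite (E j)" using fin by (rule rev_finite_subset) (auto simp: E_def)
    show "E j \<noteq> {}" using edge S by blast
    have "card (E j) \<le> card (A j \<times> A (Suc j))" using fin by (intro card_mono) (auto simp: E_def)
    also have "\<dots> \<le> N j * N (Suc j)" unfolding card_cartesian_product by (intro mult_le_mono card)
    finally show "card (E j) \<le> N j * N (Suc j)" .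
  qed
  have npos: "sqrt n > 0" using n by simp
  \<comment> \<open>Passing from sup norm to Euclidean norm costs \<open>sqrt n\<close>; after
    division by \<open>n\<close> this gives the rate \<open>1 / sqrt n\<close>.\<close>
  have sqsum: "(\<Sum>i<n. (u i)\<^sup>2) \<le> (c * sqrt n)\<^sup>2" if "\<And>i. i < n \<Longrightarrow> \<bar>u i\<bar> \<le> c" "c > 0" for u and c :: real
  proof -
    have "(\<Sum>i<n. (u i)\<^sup>2) \<le> (\<Sum>i<n. c\<^sup>2)"
      using that by (intro sum_mono) (simp add: abs_le_square_iff[symmetric])
    then show ?thesis by (simp add: power_mult_distrib mult.commute)
  qed
  have Z0: "integrable M Z0" "expectation Z0 \<le> r * sqrt n * sqrt (2 * ln (2 * real (N 0)))"
  proof -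
    have *: "(\<Sum>i<n. (f x i)\<^sup>2) \<le> (r * sqrt n)\<^sup>2" if "x \<in> A 0" for x
      using that finA[of 0] bnd r by (intro sqsum) auto
    show "integrable M Z0" "expectation Z0 \<le> r * sqrt n * sqrt (2 * ln (2 * real (N 0)))"
      unfolding Z0_def using expectation_Max_le[of "A 0" "N 0" "r * sqrt n" f] * finA A0 card npos r by auto
  qed
  have Z: "integrable M (Z j)" "expectation (Z j) \<le> 2 * r / 2 ^ j * sqrt n * sqrt (2 * ln (2 * (real (N j) * real (N (Suc j)))))" for j
  proof -
    have *: "(\<Sum>i<n. (f (snd e) i - f (fst e) i)\<^sup>2) \<le> (2 * r / 2 ^ j * sqrt n)\<^sup>2" if "e \<in> E j" for e
      using that r by (intro sqsum) (auto simp: E_def)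
    have pos: "2 * r / 2 ^ j * sqrt n > 0" using r npos by simp
    note M = expectation_Max_le[OF E pos *]
    show "integrable M (Z j)" unfolding Z_def using M(1) .
    show "expectation (Z j) \<le> 2 * r / 2 ^ j * sqrt n * sqrt (2 * ln (2 * (real (N j) * real (N (Suc j)))))"
      unfolding Z_def using M(2) by simp
  qed
  define B where "B \<omega> = (1 / real n) * (Z0 \<omega> + (\<Sum>j<J. Z j \<omega>)) + r / 2 ^ J * W \<omega>" for \<omega>
  have pointwise: "\<bar>(1 / real n) * (\<Sum>i<n. f x i * X i \<omega>)\<bar> \<le> B \<omega>" if x: "x \<in> S" for x \<omega>
  proof -
    define F where "F y = (\<Sum>i<n. f y i * X i \<omega>)" for y
    have tele: "F (\<pi> J x) = F (\<pi> 0 x) + (\<Sum>j<J. F (\<pi> (Suc j) x) - F (\<pi> j x))"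
      using sum_lessThan_telescope[of "\<lambda>j. F (\<pi> j x)" J] by simp
    have "\<bar>F (\<pi> (Suc j) x) - F (\<pi> j x)\<bar> \<le> Z j \<omega>" for j
    proof -
      have "F (\<pi> (Suc j) x) - F (\<pi> j x) = (\<Sum>i<n. (f (snd (\<pi> j x, \<pi> (Suc j) x)) i - f (fst (\<pi> j x, \<pi> (Suc j) x)) i) * X i \<omega>)"
        by (simp add: F_def sum_subtractf left_diff_distrib)
      then show ?thesis unfolding Z_def using E(1)[of j] edge[OF x, of j] by (intro Max_ge) (auto intro!: image_eqI)
    qed
    then have "\<bar>\<Sum>j<J. F (\<pi> (Suc j) x) - F (\<pi> j x)\<bar> \<le> (\<Sum>j<J. Z j \<omega>)"
      by (intro order_trans[OF sum_abs] sum_mono)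
    moreover have "\<bar>F (\<pi> 0 x)\<bar> \<le> Z0 \<omega>"
      unfolding Z0_def F_def using finA \<pi>(1)[OF x, of 0] by (intro Max_ge) auto
    ultimately have "\<bar>F (\<pi> J x)\<bar> \<le> Z0 \<omega> + (\<Sum>j<J. Z j \<omega>)" unfolding tele by linarith
    then have "(1 / real n) * \<bar>F (\<pi> J x)\<bar> \<le> (1 / real n) * (Z0 \<omega> + (\<Sum>j<J. Z j \<omega>))"
      by (intro mult_left_mono) auto
    moreover have "\<bar>(1 / real n) * F x\<bar> \<le> \<bar>(1 / real n) * F (\<pi> J x)\<bar> + r / 2 ^ J * W \<omega>"
      unfolding F_def W_def using \<pi>(2)[OF x] by (intro emp_diff_le) auto
    ultimately show ?thesis by (simp add: B_def F_def abs_mult)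
  qed
  have intW: "integrable M W"
    unfolding W_def using expectation_abs_X by (intro integrable_mult_right Bochner_Integration.integrable_sum) auto
  have intB: "integrable M B"
    unfolding B_def using Z0 Z intW
    by (intro Bochner_Integration.integrable_add integrable_mult_right Bochner_Integration.integrable_sum) auto
  have EW: "expectation W \<le> 2"
  proof -
    have "expectation W = (1 / real n) * (\<Sum>i<n. expectation (\<lambda>\<omega>. \<bar>X i \<omega>\<bar>))"
      unfolding W_def using expectation_abs_X by (simp add: Bochner_Integration.integral_sum)
    also have "\<dots> \<le> (1 / real n) * (\<Sum>i<n. 2)"
      using expectation_abs_X by (intro mult_left_mono sum_mono) auto
    also have "\<dots> = 2" using n by simp
    finally show ?thesis .
  qed
  have "emp_sup f S \<omega> \<le> B \<omega>" for \<omega>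
    unfolding emp_sup_def using S pointwise by (intro cSUP_least)
  then have "expectation (emp_sup f S) \<le> expectation B"
    using integrable_emp_sup[OF S less_imp_le[OF r] bnd net] intB by (intro integral_mono) auto
  also have "expectation B = (1 / real n) * (expectation Z0 + (\<Sum>j<J. expectation (Z j))) + r / 2 ^ J * expectation W"
    unfolding B_def using Z0 Z intW by (simp add: Bochner_Integration.integral_sum)
  also have "\<dots> \<le> (1 / real n) * (r * sqrt n * sqrt (2 * ln (2 * real (N 0))) +
      (\<Sum>j<J. 2 * r / 2 ^ j * sqrt n * sqrt (2 * ln (2 * (real (N j) * real (N (Suc j))))))) + r / 2 ^ J * 2"
    using Z0 Z EW r by (intro add_mono mult_left_mono sum_mono) auto
  also have "(\<Sum>j<J. 2 * r / 2 ^ j * sqrt n * sqrt (2 * ln (2 * (real (N j) * real (N (Suc j)))))) =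
      r * sqrt n * (\<Sum>j<J. 2 / 2 ^ j * sqrt (2 * ln (2 * (real (N j) * real (N (Suc j))))))"
    unfolding sum_distrib_left by (intro sum.cong) auto
  also have "(1 / real n) * (r * sqrt n * sqrt (2 * ln (2 * real (N 0))) + r * sqrt n * (\<Sum>j<J. 2 / 2 ^ j * sqrt (2 * ln (2 * (real (N j) * real (N (Suc j))))))) =
     (sqrt n / real n) * r * (sqrt (2 * ln (2 * real (N 0))) + (\<Sum>j<J. 2 / 2 ^ j * sqrt (2 * ln (2 * (real (N j) * real (N (Suc j)))))))"
    by (simp add: algebra_simps)
  also have "sqrt n / real n = 1 / sqrt n" using npos by (simp add: field_simps)
  finally show ?thesis by (simp add: mult.commute)
qed

end

section \<open>Complexity bounds\<close>

text \<open>This is cosh a \<le> exp(a^2/2). It follows for nonnegative arguments from the analytic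
  part of Hoeffding's lemma with weight 1/2 at \<open>2 * b\<close>, and for negative ones by
  symmetry.\<close>

lemma exp_add_exp_minus_le: "exp a + exp (- a) \<le> 2 * exp (a\<^sup>2 / 2)" for a :: real
proof -
  have pos: "exp b + exp (- b) \<le> 2 * exp (b\<^sup>2 / 2)" if "b \<ge> 0" for b :: real
  proof -
    have "- (2 * b) * (1 / 2) + ln (1 + 1 / 2 * (exp (2 * b) - 1)) \<le> (2 * b)\<^sup>2 / 8"
      using that by (intro Hoeffdings_lemma_aux) auto
    then have "ln ((1 + exp (2 * b)) / 2) \<le> b + b\<^sup>2 / 2" by (simp add: algebra_simps add_divide_distrib)
    then have "exp (ln ((1 + exp (2 * b)) / 2)) \<le> exp (b + b\<^sup>2 / 2)" by (simp only: exp_le_cancel_iff)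
    moreover have "(1 + exp (2 * b)) / 2 > 0" by (simp add: add_pos_pos)
    ultimately have "(1 + exp (2 * b)) / 2 \<le> exp (b + b\<^sup>2 / 2)" by (simp only: exp_ln)
    then have le: "1 + exp (2 * b) \<le> 2 * exp (b + b\<^sup>2 / 2)" by simp
    have "exp b + exp (- b) = exp (- b) * (1 + exp (2 * b))" by (simp add: distrib_left exp_add[symmetric])
    also have "\<dots> \<le> exp (- b) * (2 * exp (b + b\<^sup>2 / 2))" using le by (intro mult_left_mono) auto
    also have "\<dots> = 2 * exp (b\<^sup>2 / 2)" by (simp add: exp_add[symmetric])
    finally show ?thesis .
  qed
  show ?thesis using pos[of a] pos[of "- a"] by (cases "a \<ge> 0") (auto simp: add.commute)
qed

lemma subgaussian_rademacher:
  "subgaussian_family (measure_pmf (pmf_of_set ({..<n} \<rightarrow>\<^sub>E {-1, 1::real}))) n (\<lambda>i r. r i)"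
proof -
  let ?R = "{..<n} \<rightarrow>\<^sub>E {-1, 1::real}"
  have R: "finite ?R" "?R \<noteq> {}" by (auto intro!: finite_PiE simp: PiE_eq_empty_iff)
  have cardR: "card ?R = 2 ^ n" by (simp add: card_PiE numeral_2_eq_2)
  show ?thesis
  proof unfold_locales
    fix a :: "nat \<Rightarrow> real"
    show "integrable (measure_pmf (pmf_of_set ?R)) (\<lambda>r. exp (\<Sum>i<n. a i * r i))"
      using R by (intro integrable_measure_pmf_finite) simp
    have "measure_pmf.expectation (pmf_of_set ?R) (\<lambda>r. exp (\<Sum>i<n. a i * r i)) =
        (\<Sum>r\<in>?R. \<Prod>i<n. exp (a i * r i)) / 2 ^ n"
      using R by (simp add: integral_pmf_of_set cardR exp_sum)
    \<comment> \<open>Independence of the signs appears here as distributivity over the full product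
      set.\<close>
    also have "\<dots> = (\<Prod>i<n. \<Sum>x\<in>{-1, 1}. exp (a i * x)) / 2 ^ n"
      by (subst prod_sum_PiE) auto
    also have "\<dots> = (\<Prod>i<n. (\<Sum>x\<in>{-1, 1}. exp (a i * x)) / 2)"
      by (simp add: prod_dividef)
    also have "\<dots> \<le> (\<Prod>i<n. exp ((a i)\<^sup>2 / 2))"
      using exp_add_exp_minus_le by (intro prod_mono) (auto simp: add.commute add_nonneg_nonneg mult.commute[of _ 2])
    also have "\<dots> = exp ((\<Sum>i<n. (a i)\<^sup>2) / 2)"
      by (simp add: exp_sum[symmetric] sum_divide_distrib)
    finally show "measure_pmf.expectation (pmf_of_set ?R) (\<lambda>r. exp (\<Sum>i<n. a i * r i)) \<le> exp ((\<Sum>i<n. (a i)\<^sup>2) / 2)" .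
  qed auto
qed

text \<open>Completing the square: tilting the standard normal density by \<open>exp (a * x)\<close>
  gives \<open>exp (a^2 / 2)\<close> times the normal density with mean \<open>a\<close>.\<close>

lemma std_normal_mgf:
  fixes a :: real
  shows "integrable (density lborel std_normal_density) (\<lambda>x. exp (a * x))"
    and "(\<integral>x. exp (a * x) \<partial>density lborel std_normal_density) = exp (a\<^sup>2 / 2)"
proof -
  have eq: "std_normal_density x * exp (a * x) = exp (a\<^sup>2 / 2) * normal_density a 1 x" for x
    by (simp add: normal_density_def exp_add[symmetric] mult.left_commute[of "exp _"])
       (simp add: power2_eq_square field_simps)
  have "integrable lborel (\<lambda>x. std_normal_density x * exp (a * x))" unfolding eq by simp
  then show "integrable (density lborel std_normal_density) (\<lambda>x. exp (a * x))"
    by (subst integrable_density) auto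
  show "(\<integral>x. exp (a * x) \<partial>density lborel std_normal_density) = exp (a\<^sup>2 / 2)"
    by (subst integral_density) (auto simp: eq)
qed

lemma subgaussian_gauss: "subgaussian_family (gauss_measure n) n (\<lambda>i g. g i)"
proof -
  let ?N = "density lborel std_normal_density"
  interpret N: prob_space ?N by (intro prob_space_normal_density) simp
  interpret product_prob_space "\<lambda>_::nat. ?N" "{..<n}" ..
  interpret G: prob_space "gauss_measure n" unfolding gauss_measure_def by (rule prob_space_PiM) (rule N.prob_space_axioms)
  show ?thesis
  proof unfold_locales
    show "(\<lambda>g. g i) \<in> borel_measurable (gauss_measure n)" if "i < n" for i
    proof -
      have "(\<lambda>g. g i) \<in> measurable (PiM {..<n} (\<lambda>_. ?N)) ?N"
        using that by (intro measurable_component_singleton) simp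
      then show ?thesis by (simp add: gauss_measure_def cong: measurable_cong_sets)
    qed
    fix a :: "nat \<Rightarrow> real"
    show "integrable (gauss_measure n) (\<lambda>g. exp (\<Sum>i<n. a i * g i))"
      unfolding gauss_measure_def exp_sum[OF finite_lessThan]
      by (rule product_integrable_prod) (auto intro: std_normal_mgf)
    have "(\<integral>g. exp (\<Sum>i<n. a i * g i) \<partial>gauss_measure n) = (\<Prod>i<n. \<integral>x. exp (a i * x) \<partial>?N)"
      unfolding gauss_measure_def exp_sum[OF finite_lessThan]
      by (rule product_integral_prod) (auto intro: std_normal_mgf)
    also have "\<dots> = exp ((\<Sum>i<n. (a i)\<^sup>2) / 2)"
      by (simp add: std_normal_mgf exp_sum[symmetric] sum_divide_distrib)
    finally show "(\<integral>g. exp (\<Sum>i<n. a i * g i) \<partial>gauss_measure n) \<le> exp ((\<Sum>i<n. (a i)\<^sup>2) / 2)" by simp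
  qed
qed

section \<open>Numerical estimates\<close>

lemma half_le_ln_2: "1 / 2 \<le> ln (2 :: real)"
proof -
  have "exp 1 \<le> (2 :: real) ^ 2" using exp_le by simp
  then have "1 \<le> ln ((2 :: real) ^ 2)" by (subst ln_ge_iff) auto
  then have "1 \<le> real 2 * ln 2" by (subst (asm) ln_realpow) simp_all
  then show ?thesis by simp
qed

lemma curves_in_ball_nonempty: "curves_in_ball d m \<noteq> {}"
proof -
  have "replicate m (replicate d 0) \<in> curves_in_ball d m"
    by (auto simp: curves_in_ball_def in_unit_ball_def sum_list_replicate)
  then show ?thesis by blast
qed

text \<open>Bounds the entropy sum of the grid nets; induction gives the partial sums in closed
  form.\<close>

lemma sum_Suc_div_power2_le: "(\<Sum>j<J. real (Suc j) / 2 ^ j) \<le> 4"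
proof -
  have "(\<Sum>j<J. real (Suc j) / 2 ^ j) = 4 - (2 * J + 4) / 2 ^ J"
  proof (induction J)
    case (Suc J)
    have "(\<Sum>j<Suc J. real (Suc j) / 2 ^ j) = 4 - (2 * J + 4) / 2 ^ J + real (Suc J) / 2 ^ J"
      using Suc by simp
    also have "\<dots> = 4 - (2 * Suc J + 4) / 2 ^ Suc J" by (simp add: field_simps)
    finally show ?case .
  qed simp
  then show ?thesis by simp
qed

text \<open>Supplies the truncation scale: \<open>2^J \<ge> n\<close> makes the remainder
  negligible, while \<open>2^J \<le> 2 * n\<close> keeps \<open>J\<close> logarithmic in
  \<open>n\<close>.\<close>

lemma exists_power2_between:
  assumes "n \<ge> 1"
  shows "\<exists>J. n \<le> 2 ^ J \<and> (2::nat) ^ J \<le> 2 * n"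
proof -
  define J where "J = (LEAST J. n \<le> 2 ^ J)"
  have J: "n \<le> 2 ^ J" unfolding J_def by (rule LeastI[of _ n]) (simp add: less_imp_le)
  have "(2::nat) ^ J \<le> 2 * n"
  proof (cases J)
    case (Suc J')
    then have "\<not> n \<le> 2 ^ J'" using not_less_Least[of J' "\<lambda>J. n \<le> 2 ^ J"] by (simp add: J_def)
    then show ?thesis using Suc by simp
  qed (use assms in simp)
  with J show ?thesis by blast
qed

section \<open>Expected suprema for k-DTW and DTW\<close>

context subgaussian_family
begin

lemma integrable_emp_sup_kdtw:
  assumes "d \<ge> 1" "m \<ge> 1" "\<And>i. i < n \<Longrightarrow> P i \<in> curves_in_ball d m"
  shows "integrable M (emp_sup (\<lambda>\<psi> i. kdtw k (P i) \<psi>) (curves_in_ball d m))"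
proof -
  have "\<forall>j. \<exists>A. sup_net n (\<lambda>\<psi> i. kdtw k (P i) \<psi>) (curves_in_ball d m) (2 * real k / 2 ^ j) A"
  proof
    show "\<exists>A. sup_net n (\<lambda>\<psi> i. kdtw k (P i) \<psi>) (curves_in_ball d m) (2 * real k / 2 ^ j) A" for j
      using kdtw_net_grid[of d m n P k j, OF assms] by (auto simp: mult.commute)
  qed
  from choice[OF this] obtain A where "\<And>j. sup_net n (\<lambda>\<psi> i. kdtw k (P i) \<psi>) (curves_in_ball d m) (2 * real k / 2 ^ j) (A j)"
    by blast
  then show ?thesis
    using kdtw_bounds[OF assms(2,3)] curves_in_ball_nonempty
    by (intro integrable_emp_sup[where A = A and r = "2 * real k"]) auto
qed

text \<open>Chaining with \<open>r = 2 * k\<close>, where \<open>b j\<close> majorises the entropy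
  root at scale \<open>j\<close>. Since \<open>2^J \<ge> n \<ge> sqrt n\<close>, the remainder
  becomes the summand 2 in the bracket.\<close>

lemma expectation_emp_sup_kdtw_chaining:
  fixes N :: "nat \<Rightarrow> nat" and b :: "nat \<Rightarrow> real"
  assumes "k \<ge> 1" "n \<ge> 1" "m \<ge> 1" "\<And>i. i < n \<Longrightarrow> P i \<in> curves_in_ball d m"
    and net: "\<And>j. \<exists>A. sup_net n (\<lambda>\<psi> i. kdtw k (P i) \<psi>) (curves_in_ball d m) (k * (2 / 2 ^ j)) A \<and> card A \<le> N j"
    and N: "\<And>j. N j \<ge> 1" and b: "\<And>j. b j \<ge> 0" "\<And>j. 2 * ln (2 * (real (N j) * real (N (Suc j)))) \<le> (b j)\<^sup>2"
    and J: "n \<le> 2 ^ J"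
  shows "expectation (emp_sup (\<lambda>\<psi> i. kdtw k (P i) \<psi>) (curves_in_ball d m)) \<le>
    2 * real k / sqrt n * (2 + b 0 + 2 * (\<Sum>j<J. b j / 2 ^ j))"
proof -
  let ?f = "\<lambda>\<psi> i. kdtw k (P i) \<psi>"
  let ?S = "curves_in_ball d m"
  have "\<forall>j. \<exists>A. sup_net n ?f ?S (2 * real k / 2 ^ j) A \<and> card A \<le> N j"
    using net by (simp add: mult.commute)
  from choice[OF this] obtain A where A: "\<And>j. sup_net n ?f ?S (2 * real k / 2 ^ j) (A j)" "\<And>j. card (A j) \<le> N j"
    by blast
  have sq: "sqrt (2 * ln (2 * (real (N j) * real (N (Suc j))))) \<le> b j" for j
    using b[of j] by (intro real_le_lsqrt) auto
  have sq0: "sqrt (2 * ln (2 * real (N 0))) \<le> b 0"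
  proof -
    have "1 * real (N 0) \<le> real (N 1) * real (N 0)" using N[of 1] by (intro mult_right_mono) auto
    then have "ln (2 * real (N 0)) \<le> ln (2 * (real (N 0) * real (N 1)))"
      using N[of 0] N[of 1] by (simp add: mult.commute)
    then have "sqrt (2 * ln (2 * real (N 0))) \<le> sqrt (2 * ln (2 * (real (N 0) * real (N 1))))" by simp
    also have "\<dots> \<le> b 0" using sq[of 0] by simp
    finally show ?thesis .
  qed
  have n0: "real n > 0" using assms by simp
  have "expectation (emp_sup ?f ?S) \<le> (2 * real k) / sqrt n * (sqrt (2 * ln (2 * real (N 0))) +
     (\<Sum>j<J. 2 / 2 ^ j * sqrt (2 * ln (2 * (real (N j) * real (N (Suc j))))))) + 2 * (2 * real k) / 2 ^ J"
    using A kdtw_bounds[OF assms(3,4)] curves_in_ball_nonempty assms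
    by (intro expectation_emp_sup_chaining[where A = A]) auto
  also have "\<dots> \<le> (2 * real k) / sqrt n * (b 0 + (\<Sum>j<J. 2 / 2 ^ j * b j)) + (2 * real k) / sqrt n * 2"
  proof (intro add_mono mult_left_mono sum_mono)
    show "sqrt (2 * ln (2 * (real (N j) * real (N (Suc j))))) \<le> b j" for j using sq[of j] by simp
    have "sqrt n \<le> real n" using assms by (simp add: real_le_lsqrt power2_eq_square)
    also have "\<dots> \<le> 2 ^ J" using J by (metis of_nat_le_iff of_nat_numeral of_nat_power)
    finally have "2 * (2 * real k) / 2 ^ J \<le> 2 * (2 * real k) / sqrt n"
      using n0 by (intro divide_left_mono) auto
    then show "2 * (2 * real k) / 2 ^ J \<le> 2 * real k / sqrt n * 2" by (simp add: mult.commute)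
  qed (use sq0 in auto)
  also have "\<dots> = 2 * real k / sqrt n * (2 + b 0 + 2 * (\<Sum>j<J. b j / 2 ^ j))"
    by (simp add: sum_distrib_left distrib_left)
  finally show ?thesis .
qed

text \<open>The entropy roots of the grid nets grow only linearly in \<open>j\<close>, so their sum
  against \<open>2^-j\<close> converges and no logarithm of \<open>n\<close> appears.\<close>

lemma expectation_emp_sup_kdtw_dimension:
  assumes "d \<ge> 1" "m \<ge> 1" "n \<ge> 1" "k \<ge> 1" and P: "\<And>i. i < n \<Longrightarrow> P i \<in> curves_in_ball d m"
  shows "expectation (emp_sup (\<lambda>\<psi> i. kdtw k (P i) \<psi>) (curves_in_ball d m)) \<le> 94 * real k * sqrt (real d * real m) / sqrt n"
proof -
  define q where "q = sqrt (real d * real m)"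
  have dm: "real d * real m \<ge> 1" using assms(1,2) mult_mono[of 1 "real d" 1 "real m"] by simp
  then have q: "q \<ge> 1" "q\<^sup>2 = (real d * real m)" by (auto simp: q_def)
  obtain J where J: "n \<le> 2 ^ J" using exists_power2_between[OF assms(3)] by blast
  have "expectation (emp_sup (\<lambda>\<psi> i. kdtw k (P i) \<psi>) (curves_in_ball d m)) \<le>
     2 * real k / sqrt n * (2 + 5 * real (Suc 0) * q + 2 * (\<Sum>j<J. 5 * real (Suc j) * q / 2 ^ j))"
  proof (rule expectation_emp_sup_kdtw_chaining[where N = "\<lambda>j. 2 ^ ((j + 5) * d * m)"])
    fix j
    have "2 * ln (2 * (real (2 ^ ((j + 5) * d * m)) * real (2 ^ ((Suc j + 5) * d * m)))) =
        2 * ln (2 ^ (1 + (2 * j + 11) * (d * m)))"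
      by (simp add: power_add[symmetric] algebra_simps)
    also have "\<dots> = 2 * (1 + (2 * real j + 11) * (real d * real m)) * ln 2"
      by (subst ln_realpow) (simp_all add: algebra_simps)
    also have "\<dots> \<le> 2 * (1 + (2 * real j + 11) * (real d * real m)) * 1"
      using ln_2_less_1 by (intro mult_left_mono) auto
    also have "\<dots> \<le> 2 * ((real d * real m) + (2 * real j + 11) * (real d * real m))" using dm by simp
    also have "\<dots> = (4 * real j + 24) * q\<^sup>2" unfolding q by (simp add: algebra_simps)
    also have "\<dots> \<le> (5 * real (Suc j))\<^sup>2 * q\<^sup>2"
      by (intro mult_right_mono) (auto simp: power2_eq_square algebra_simps)
    finally show "2 * ln (2 * (real (2 ^ ((j + 5) * d * m)) * real (2 ^ ((Suc j + 5) * d * m)))) \<le> (5 * real (Suc j) * q)\<^sup>2"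
      by (simp add: power_mult_distrib)
  qed (use assms J q kdtw_net_grid[of d m n P k, OF assms(1,2) P] in auto)
  also have "(\<Sum>j<J. 5 * real (Suc j) * q / 2 ^ j) = 5 * q * (\<Sum>j<J. real (Suc j) / 2 ^ j)"
    unfolding sum_distrib_left by (intro sum.cong) auto
  \<comment> \<open>As \<open>q \<ge> 1\<close>, the bracket is at most
    \<open>(2 + 5 + 40) * q\<close>; doubling gives 94.\<close>
  also have "2 * real k / sqrt n * (2 + 5 * real (Suc 0) * q + 2 * (5 * q * (\<Sum>j<J. real (Suc j) / 2 ^ j))) \<le>
      2 * real k / sqrt n * (2 * q + 5 * q + 2 * (5 * q * 4))"
    using q sum_Suc_div_power2_le by (intro mult_left_mono add_mono) auto
  finally show ?thesis by (simp add: q_def)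
qed

text \<open>Here the entropy roots grow like \<open>2^j\<close> and cancel the weights, so every
  scale contributes the same amount. The number \<open>J\<close> of scales gives one logarithm and
  \<open>q\<close> the root of another.\<close>

lemma expectation_emp_sup_kdtw_dimension_free:
  assumes "m \<ge> 2" "n \<ge> 1" "k \<ge> 1" and P: "\<And>i. i < n \<Longrightarrow> P i \<in> curves_in_ball d m"
  shows "expectation (emp_sup (\<lambda>\<psi> i. kdtw k (P i) \<psi>) (curves_in_ball d m)) \<le>
    736 * real k * sqrt (real m) * (ln (real m * real n))\<^sup>2 / sqrt n"
proof -
  define l where "l = ln (real m * real n)"
  define q where "q = sqrt (real m * l)"
  have ln2: "ln 2 \<ge> (1/2 :: real)" by (rule half_le_ln_2)
  have mn: "real m * real n \<ge> 2 * real n" "real n \<ge> 1" using assms by auto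
  have "ln 2 + ln n = ln (2 * real n)" using mn by (simp add: ln_mult)
  also have "\<dots> \<le> l" unfolding l_def using mn by (subst ln_le_cancel_iff) auto
  finally have l: "l \<ge> ln 2 + ln n" .
  then have l2: "l \<ge> ln 2" using mn ln_ge_zero[of "real n"] by linarith
  have ml: "real m * l \<ge> 2 * (1/2)" using assms l2 ln2 by (intro mult_mono) auto
  then have q: "q \<ge> 1" "q\<^sup>2 = real m * l" by (auto simp: q_def)
  obtain J where J: "n \<le> 2 ^ J" "2 ^ J \<le> 2 * n" using exists_power2_between[OF assms(2)] by blast
  have Jl: "real J \<le> 2 * l"
  proof -
    have "real J * ln 2 = ln (real (2 ^ J))" by (simp add: ln_realpow)
    also have "\<dots> \<le> ln (real (2 * n))" using J(2) assms(2) by (subst ln_le_cancel_iff) (auto simp del: of_nat_power of_nat_mult)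
    also have "\<dots> = ln 2 + ln n" using mn by (simp add: ln_mult)
    finally have "real J * ln 2 \<le> l" using l by simp
    moreover have "real J * (1/2) \<le> real J * ln 2" using ln2 by (intro mult_left_mono) auto
    ultimately show ?thesis by simp
  qed
  have N1: "m * n \<ge> 1" using assms by simp
  have "expectation (emp_sup (\<lambda>\<psi> i. kdtw k (P i) \<psi>) (curves_in_ball d m)) \<le>
     2 * real k / sqrt n * (2 + 30 * 2 ^ 0 * q + 2 * (\<Sum>j<J. 30 * 2 ^ j * q / 2 ^ j))"
  proof (rule expectation_emp_sup_kdtw_chaining[where N = "\<lambda>j. (m * n) ^ (79 * 4 ^ j * m)"])
    fix j
    have pos: "real (m * n) > 0" using N1 by linarith
    have lmn: "ln (real (m * n)) = l" by (simp add: l_def)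
    have "ln (2 * (real ((m * n) ^ (79 * 4 ^ j * m)) * real ((m * n) ^ (79 * 4 ^ Suc j * m)))) =
       ln 2 + (ln (real (m * n) ^ (79 * 4 ^ j * m)) + ln (real (m * n) ^ (79 * 4 ^ Suc j * m)))"
      using pos by (simp add: ln_mult del: of_nat_mult)
    also have "\<dots> = ln 2 + (real (79 * 4 ^ j * m) * l + real (79 * 4 ^ Suc j * m) * l)"
      using pos lmn by (simp add: ln_realpow del: of_nat_mult)
    \<comment> \<open>395 is 79 * (1 + 4), from scales \<open>j\<close> and \<open>Suc j\<close>.
      Absorbing \<open>ln 2\<close> and doubling gives 792, rounded up to the square 900.\<close>
    also have "\<dots> = ln 2 + 395 * 4 ^ j * (m * l)" by (simp add: algebra_simps)
    also have "ln 2 \<le> 1 * (m * l)" using ml ln_2_less_1 by simp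
    also have "1 * (m * l) \<le> 4 ^ j * (m * l)" using ml by (intro mult_right_mono) auto
    finally have "2 * ln (2 * (real ((m * n) ^ (79 * 4 ^ j * m)) * real ((m * n) ^ (79 * 4 ^ Suc j * m)))) \<le> 792 * (4 ^ j * q\<^sup>2)"
      unfolding q by simp
    also have "\<dots> \<le> 900 * (4 ^ j * q\<^sup>2)" by (intro mult_right_mono) auto
    also have "\<dots> = (30 * 2 ^ j * q)\<^sup>2"
      by (simp add: power_mult_distrib power_mult[symmetric] mult.commute[of j]) (simp add: power_mult)
    finally show "2 * ln (2 * (real ((m * n) ^ (79 * 4 ^ j * m)) * real ((m * n) ^ (79 * 4 ^ Suc j * m)))) \<le> (30 * 2 ^ j * q)\<^sup>2" .
  qed (use assms J q N1 kdtw_net_dimension_free[of m n P d k, OF assms(1,2) P] in auto)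
  also have "(\<Sum>j<J. 30 * 2 ^ j * q / 2 ^ j) = 30 * real J * q" by simp
  also have "2 * real k / sqrt n * (2 + 30 * 2 ^ 0 * q + 2 * (30 * real J * q)) \<le>
     2 * real k / sqrt n * (2 * q + 30 * q + 2 * (30 * (2 * l) * q))"
    using q Jl by (intro mult_left_mono add_mono mult_right_mono) auto
  also have "\<dots> = 2 * real k / sqrt n * (q * (32 + 120 * l))" by (simp add: algebra_simps)
  \<comment> \<open>As \<open>l \<ge> 1 / 2\<close>, the power 3/2 of the logarithm is rounded up to
    a square: \<open>sqrt l \<le> 2 * l\<close> and \<open>32 \<le> 64 * l\<close>.\<close>
  also have "\<dots> \<le> 2 * real k / sqrt n * ((sqrt m * (2 * l)) * (184 * l))"
  proof (intro mult_left_mono mult_mono)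
    have "l * 1 \<le> l * (4 * l)" using l2 ln2 by (intro mult_left_mono) auto
    then have "sqrt l \<le> 2 * l" using l2 ln2 by (intro real_le_lsqrt) (auto simp: power2_eq_square)
    then show "q \<le> sqrt m * (2 * l)" unfolding q_def real_sqrt_mult by (intro mult_left_mono) auto
  qed (use l2 ln2 in auto)
  also have "\<dots> = 736 * real k * sqrt (real m) * l\<^sup>2 / sqrt n" by (simp add: power2_eq_square)
  finally show ?thesis by (simp add: l_def)
qed

text \<open>The smaller term of the minimum decides which bound is applied. The factor
  \<open>ln k\<close> is introduced by \<open>1 \<le> 4 * ln k\<close>, and the factor
  \<open>k^2\<close> under the root by \<open>k \<ge> 1\<close>.\<close>

lemma expectation_emp_sup_kdtw:
  assumes "d \<ge> 1" "m \<ge> 2" "n \<ge> 1" "k \<ge> 2" and P: "\<And>i. i < n \<Longrightarrow> P i \<in> curves_in_ball d m"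
  shows "expectation (emp_sup (\<lambda>\<psi> i. kdtw k (P i) \<psi>) (curves_in_ball d m)) \<le>
    736 * sqrt (real m * real k ^ 2 * min (real d * ln (real k)) (real k ^ 2 * ln (real m * real n) ^ 4) / real n)"
    (is "?E \<le> 736 * sqrt (real m * real k ^ 2 * min ?a ?b / real n)")
proof (cases "?a \<le> ?b")
  case True
  have ln2: "ln 2 \<ge> (1/2 :: real)" by (rule half_le_ln_2)
  have "?E \<le> 94 * real k * sqrt (real d * real m) / sqrt n"
    using assms by (intro expectation_emp_sup_kdtw_dimension) auto
  also have "\<dots> = 94 * sqrt (real m * real k ^ 2 * real d / real n)"
    by (simp add: real_sqrt_mult real_sqrt_divide)
  also have "\<dots> \<le> 94 * sqrt (2\<^sup>2 * (real m * real k ^ 2 * (real d * ln (real k)) / real n))"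
  proof (intro mult_left_mono real_sqrt_le_mono)
    have "ln 2 \<le> ln k" using assms by simp
    then have "1 \<le> 4 * ln k" using ln2 by linarith
    then have "(real m * real k ^ 2 * real d / real n) * 1 \<le> (real m * real k ^ 2 * real d / real n) * (4 * ln k)" by (intro mult_left_mono) auto
    then show "real m * real k ^ 2 * real d / real n \<le> 2\<^sup>2 * (real m * real k ^ 2 * (real d * ln (real k)) / real n)" by (simp add: mult_ac)
  qed simp
  also have "\<dots> = 188 * sqrt (real m * real k ^ 2 * (real d * ln (real k)) / real n)"
    unfolding real_sqrt_mult[of "2\<^sup>2"] by simp
  also have "\<dots> \<le> 736 * sqrt (real m * real k ^ 2 * (real d * ln (real k)) / real n)"
    using assms by (intro mult_right_mono) auto
  finally show ?thesis using True by (simp add: min_def)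
next
  case False
  have "?E \<le> 736 * real k * sqrt (real m) * (ln (real m * real n))\<^sup>2 / sqrt n"
    using assms by (intro expectation_emp_sup_kdtw_dimension_free) auto
  also have "\<dots> \<le> 736 * (real k * real k) * sqrt (real m) * (ln (real m * real n))\<^sup>2 / sqrt n"
    using assms mult_left_mono[of 1 "real k" "real k"] by (intro divide_right_mono mult_right_mono) auto
  also have "\<dots> = 736 * sqrt (real m * real k ^ 2 * (real k ^ 2 * ln (real m * real n) ^ 4) / real n)"
  proof -
    have "ln (real m * real n) ^ 4 = ((ln (real m * real n))\<^sup>2)\<^sup>2" by (simp add: power_mult[symmetric])
    then have "sqrt (ln (real m * real n) ^ 4) = (ln (real m * real n))\<^sup>2" by (simp only: real_sqrt_abs abs_power2)
    then show ?thesis by (simp add: real_sqrt_mult real_sqrt_divide)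
  qed
  finally show ?thesis using False by (simp add: min_def)
qed

lemma expectation_emp_sup_dtw:
  assumes "d \<ge> 1" "m \<ge> 2" "n \<ge> 1" and P: "\<And>i. i < n \<Longrightarrow> P i \<in> curves_in_ball d m"
  shows "integrable M (emp_sup (\<lambda>\<psi> i. dtw (P i) \<psi>) (curves_in_ball d m))"
    and "expectation (emp_sup (\<lambda>\<psi> i. dtw (P i) \<psi>) (curves_in_ball d m)) \<le>
      6624 * sqrt (real m ^ 3 * min (real d * ln (real m)) (real m ^ 2 * ln (real m * real n) ^ 4) / real n)"
proof -
  \<comment> \<open>The bound on the length of a traversal between two curves of complexity
    \<open>m\<close>.\<close>
  define k where "k = 2 * m + 1"
  have eq: "emp_sup (\<lambda>\<psi> i. dtw (P i) \<psi>) (curves_in_ball d m) = emp_sup (\<lambda>\<psi> i. kdtw k (P i) \<psi>) (curves_in_ball d m)"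
  proof
    fix \<omega>
    have "dtw (P i) \<psi> = kdtw k (P i) \<psi>" if "i < n" "\<psi> \<in> curves_in_ball d m" for i \<psi>
      using P[OF that(1)] that(2) by (intro dtw_eq_kdtw) (auto simp: k_def curves_in_ball_def)
    then show "emp_sup (\<lambda>\<psi> i. dtw (P i) \<psi>) (curves_in_ball d m) \<omega> = emp_sup (\<lambda>\<psi> i. kdtw k (P i) \<psi>) (curves_in_ball d m) \<omega>"
      unfolding emp_sup_def by (intro SUP_cong refl arg_cong[where f = "\<lambda>x. \<bar>(1 / real n) * x\<bar>"] sum.cong) auto
  qed
  show "integrable M (emp_sup (\<lambda>\<psi> i. dtw (P i) \<psi>) (curves_in_ball d m))"
    unfolding eq using assms by (intro integrable_emp_sup_kdtw) auto
  define L where "L = ln (real m * real n) ^ 4"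
  have L: "L \<ge> 0" unfolding L_def by simp
  have k3: "real k \<le> 3 * real m" using assms by (simp add: k_def)
  \<comment> \<open>Since \<open>m \<ge> 2\<close>, \<open>k \<le> 3 * m \<le> m^3\<close>, which
    turns \<open>ln k\<close> into a multiple of \<open>ln m\<close> with no additive
    constant.\<close>
  have "ln (real k) \<le> ln (real m ^ 3)"
  proof (subst ln_le_cancel_iff)
    have "3 * m \<le> m * m * m" using mult_le_mono[OF assms(2) assms(2)] by (intro mult_le_mono) auto
    then have "3 * real m \<le> real m ^ 3" unfolding power3_eq_cube by (metis of_nat_le_iff of_nat_mult of_nat_numeral)
    with k3 show "real k \<le> real m ^ 3" by (rule order_trans)
  qed (use assms in \<open>auto simp: k_def\<close>)
  also have "\<dots> = 3 * ln m" using assms by (simp add: ln_realpow)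
  finally have lnk: "ln k \<le> 3 * ln m" .
  have lnm: "ln m \<ge> 0" using assms by simp
  have k2: "real k ^ 2 \<le> 9 * real m ^ 2" using power_mono[OF k3, of 2] by (simp add: power_mult_distrib)
  have "expectation (emp_sup (\<lambda>\<psi> i. dtw (P i) \<psi>) (curves_in_ball d m)) \<le>
      736 * sqrt (real m * real k ^ 2 * min (real d * ln (real k)) (real k ^ 2 * L) / real n)"
    unfolding eq L_def using assms by (intro expectation_emp_sup_kdtw) (auto simp: k_def)
  \<comment> \<open>One factor 9 comes from \<open>k^2 \<le> 9 * m^2\<close> outside the minimum,
    one from inside; their root is 9, and 9 * 736 = 6624.\<close>
  also have "\<dots> \<le> 736 * sqrt (real m * (9 * real m ^ 2) * (9 * min (real d * ln m) (real m ^ 2 * L)) / real n)"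
  proof (intro mult_left_mono real_sqrt_le_mono divide_right_mono mult_mono k2)
    have "real d * ln k \<le> 9 * (real d * ln m)"
    proof -
      have "real d * ln k \<le> real d * (9 * ln m)" using lnk lnm by (intro mult_left_mono) auto
      then show ?thesis by simp
    qed
    moreover have "real k ^ 2 * L \<le> 9 * (real m ^ 2 * L)" using mult_right_mono[OF k2 L] by simp
    ultimately show "min (real d * ln (real k)) (real k ^ 2 * L) \<le> 9 * min (real d * ln m) (real m ^ 2 * L)" by linarith
    show "0 \<le> min (real d * ln (real k)) (real k ^ 2 * L)" using L by (auto simp: k_def)
  qed auto
  also have "\<dots> = 736 * sqrt (9\<^sup>2 * (real m ^ 3 * min (real d * ln m) (real m ^ 2 * L) / real n))"
    by (simp add: power3_eq_cube power2_eq_square mult_ac)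
  also have "\<dots> = 6624 * sqrt (real m ^ 3 * min (real d * ln m) (real m ^ 2 * L) / real n)"
    unfolding real_sqrt_mult[of "9\<^sup>2"] by simp
  finally show "expectation (emp_sup (\<lambda>\<psi> i. dtw (P i) \<psi>) (curves_in_ball d m)) \<le>
      6624 * sqrt (real m ^ 3 * min (real d * ln (real m)) (real m ^ 2 * ln (real m * real n) ^ 4) / real n)"
    by (simp add: L_def)
qed

end

section \<open>Both complexities for both distances\<close>

theorem theorem4p1:
  "\<exists>C>0. \<forall>d m n k (P :: nat \<Rightarrow> curve).
     d \<ge> 1 \<and> m \<ge> 2 \<and> n \<ge> 1 \<and> k \<ge> 2 \<and> (\<forall>i<n. P i \<in> curves_in_ball d m) \<longrightarrow>
       (let B_dtw = C * sqrt (real m ^ 3 * min (real d * ln (real m)) (real m ^ 2 * (ln (real m * real n)) ^ 4) / real n);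
            B_kdtw = C * sqrt (real m * real k ^ 2 * min (real d * ln (real k)) (real k ^ 2 * (ln (real m * real n)) ^ 4) / real n)
        in rademacher_complexity dtw d m n P \<le> B_dtw
         \<and> integrable (gauss_measure n) (gaussian_sup dtw d m n P)
         \<and> gaussian_complexity dtw d m n P \<le> B_dtw
         \<and> rademacher_complexity (kdtw k) d m n P \<le> B_kdtw
         \<and> integrable (gauss_measure n) (gaussian_sup (kdtw k) d m n P)
         \<and> gaussian_complexity (kdtw k) d m n P \<le> B_kdtw)"
\<comment> \<open>6624 is the DTW constant; it dominates the constant 736 obtained for
  k-DTW.\<close>
proof (intro exI[of _ 6624] conjI allI impI)
  fix d m n k :: nat and P :: "nat \<Rightarrow> curve"
  assume "d \<ge> 1 \<and> m \<ge> 2 \<and> n \<ge> 1 \<and> k \<ge> 2 \<and> (\<forall>i<n. P i \<in> curves_in_ball d m)"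
  then have H: "d \<ge> 1" "m \<ge> 2" "n \<ge> 1" "k \<ge> 2" "\<And>i. i < n \<Longrightarrow> P i \<in> curves_in_ball d m" by auto
  have m1: "m \<ge> 1" using H by simp
  let ?R = "{..<n} \<rightarrow>\<^sub>E {-1, 1::real}"
  interpret R: subgaussian_family "measure_pmf (pmf_of_set ?R)" n "\<lambda>i r. r i" by (rule subgaussian_rademacher)
  interpret G: subgaussian_family "gauss_measure n" n "\<lambda>i g. g i" by (rule subgaussian_gauss)
  have rad: "rademacher_complexity D d m n P = measure_pmf.expectation (pmf_of_set ?R) (R.emp_sup (\<lambda>\<psi> i. D (P i) \<psi>) (curves_in_ball d m))" for D
  proof -
    have "finite ?R" "?R \<noteq> {}" by (auto intro!: finite_PiE simp: PiE_eq_empty_iff)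
    then show ?thesis
      by (simp add: rademacher_complexity_def integral_pmf_of_set R.emp_sup_def card_PiE numeral_2_eq_2[symmetric])
  qed
  have gs: "gaussian_sup D d m n P = G.emp_sup (\<lambda>\<psi> i. D (P i) \<psi>) (curves_in_ball d m)" for D
    by (simp add: fun_eq_iff gaussian_sup_def G.emp_sup_def)
  have gc: "gaussian_complexity D d m n P = integral\<^sup>L (gauss_measure n) (G.emp_sup (\<lambda>\<psi> i. D (P i) \<psi>) (curves_in_ball d m))" for D
    unfolding gaussian_complexity_def gs ..
  let ?B = "sqrt (real m * real k ^ 2 * min (real d * ln (real k)) (real k ^ 2 * (ln (real m * real n)) ^ 4) / real n)"
  have B: "736 * ?B \<le> 6624 * ?B"
    using H by (intro mult_right_mono real_sqrt_ge_zero divide_nonneg_nonneg mult_nonneg_nonneg) auto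
  show "let B_dtw = 6624 * sqrt (real m ^ 3 * min (real d * ln (real m)) (real m ^ 2 * (ln (real m * real n)) ^ 4) / real n);
            B_kdtw = 6624 * ?B
        in rademacher_complexity dtw d m n P \<le> B_dtw
         \<and> integrable (gauss_measure n) (gaussian_sup dtw d m n P)
         \<and> gaussian_complexity dtw d m n P \<le> B_dtw
         \<and> rademacher_complexity (kdtw k) d m n P \<le> B_kdtw
         \<and> integrable (gauss_measure n) (gaussian_sup (kdtw k) d m n P)
         \<and> gaussian_complexity (kdtw k) d m n P \<le> B_kdtw"
    unfolding Let_def rad gc gs
    by (intro conjI R.expectation_emp_sup_dtw G.expectation_emp_sup_dtw G.integrable_emp_sup_kdtw H m1
        order_trans[OF R.expectation_emp_sup_kdtw B] order_trans[OF G.expectation_emp_sup_kdtw B])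
qed simp

end
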